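(* Let $\mu$ be a doubling Radon measure on $\mathbb{R}^n$, $\gamma\ne0$, $1\le p<\infty$, and $f\in L^1_{\rm loc}(\mathbb{R}^n,\mu)$. (i) Set $a(f)_Q=\ell(Q)^{\gamma/p}\frac1{\mu(Q)}\int_Qf\,d\mu$ for $Q\in\mathcal{D}$ and $a(f)(x,t)=t^{\gamma/p}\frac1{\mu(B(x,t))}\int_{B(x,t)}f\,d\mu$ for $(x,t)\in\mathbb{R}^{n+1}_+$. If $f$ is nonnegative then $$\|a(f)\|_{l^{p,\infty}_\gamma(\mathbb{R}^n,\mu)}\approx\|a(f)\|_{L^{p,\infty}(\mathbb{R}^{n+1}_+,\nu_\gamma)}\quad\text{and}\quad[a(f)]_{l^{p,\infty}_\gamma(\mathbb{R}^n,\mu)}\approx[a(f)]_{L^{p,\infty}(\mathbb{R}^{n+1}_+,\nu_\gamma)}.$$ For (ii) and (iii) let $\mu$ be Lebesgue measure and let $\{\mathcal{D}_j\}_{j=1}^{n+1}$ be a family of dyadic systems of cubes in $\mathbb{R}^n$ for which there is a constant $C$ such that for every ball $B$ there are $j\in\{1,\dots,n+1\}$ and a cube $Q\in\mathcal{D}_j$ with $B\subset Q$ and $|Q|\le C|B|$. (ii) Set $b(f)_Q=\ell(Q)^{\gamma/p}O(f,Q)$ for cubes $Q$ and $b(f)(x,t)=t^{\gamma/p}O(f,B(x,t))$ for $(x,t)\in\mathbb{R}^{n+1}_+$. Then $$\|b(f)\|_{l^{p,\infty}_\gamma(\mathbb{R}^n)}\lesssim\|b(f)\|_{L^{p,\infty}(\mathbb{R}^{n+1}_+,\nu_\gamma)}\lesssim\max_{j=1,\dots,n+1}\|b(f)\|_{l^{p,\infty}_\gamma(\mathbb{R}^n,\mathcal{D}_j)}.$$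 (iii) Let $\gamma=p$ and $m(f)(x,r)=O(f,B(x,r))$ for $(x,r)\in\mathbb{R}^{n+1}_+$. Then $$\|f\|_{\mathcal{O}^p(\mathbb{R}^n)}\lesssim\|m(f)\|_{L^{p,\infty}(\mathbb{R}^{n+1}_+,\nu_p)}\lesssim\max_{j=1,\dots,n+1}\|f\|_{\mathcal{O}^p(\mathbb{R}^n,\mathcal{D}_j)}.$$ All implied constants are independent of $f$.
   Context: $\mathcal{D}$ is the classical collection of half-open dyadic cubes $[j_12^k,(j_1+1)2^k)\times\cdots\times[j_n2^k,(j_n+1)2^k)$, $k\in\mathbb{Z}$, $j\in\mathbb{Z}^n$. $\ell(Q)$ is the sidelength of $Q$, $B(x,t)$ the ball with center $x$ and radius $t$, $\mathbb{R}^{n+1}_+=\mathbb{R}^n\times(0,\infty)$. $\mu$ is doubling if there is $C_D$ with $0<\mu(2B)\le C_D\,\mu(B)$ for all balls $B$, where $2B$ is the concentric ball of twice the radius. $A\lesssim B$ means $A\le cB$ for a constant $c$; $A\approx B$ means $A\lesssim B\lesssim A$. A dyadic system of cubes $\mathcal{D}'$ in $\mathbb{R}^n$ is a collection of (half-open, axis-parallel) cubes such that: any two cubes in $\mathcal{D}'$ are disjoint or nested; if $Q\in\mathcal{D}'$ then the children of $Q$ (the cubes obtained by bisecting its sides) are in $\mathcal{D}'$; any cube in $\mathcal{D}'$ is a child of another cube of $\mathcal{D}'$; the cubes in $\mathcal{D}'$ of a fixed length partition $\mathbb{R}^n$. The measure $\nu_\gamma$ on $\mathbb{R}^{n+1}_+$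 is $d\nu_\gamma(x,t)=\frac{d\mu(x)\,dt}{t^{1+\gamma}}$. For Lebesgue measure, $O(f,E)=\frac1{|E|}\int_E|f-f_E|$ with $f_E=\frac1{|E|}\int_Ef$. For a dyadic system $\mathcal{D}'$ and a sequence $a=\{a_Q\}_{Q\in\mathcal{D}'}$, $$\|a\|_{l^{p,\infty}_\gamma(\mathbb{R}^n,\mu,\mathcal{D}')}=\Big(\sup_{\lambda>0}\lambda^p\sum_{Q\in\mathcal{D}',|a_Q|>\lambda}\ell(Q)^{-\gamma}\mu(Q)\Big)^{1/p},$$ and $[a]_{l^{p,\infty}_\gamma(\mathbb{R}^n,\mu,\mathcal{D}')}$ is the same expression with $\sup_{\lambda>0}$ replaced by $\liminf_{\lambda\to0^+}$ if $\gamma>0$ and by $\limsup_{\lambda\to\infty}$ if $\gamma<0$; $\mathcal{D}'$ is omitted when it equals $\mathcal{D}$, and $\mu$ is omitted when it is Lebesgue measure. For a measurable function $F$ on $\mathbb{R}^{n+1}_+$, $\|F\|_{L^{p,\infty}(\mathbb{R}^{n+1}_+,\nu_\gamma)}=(\sup_{\lambda>0}\lambda^p\nu_\gamma(\{|F|>\lambda\}))^{1/p}$, and $[F]_{L^{p,\infty}(\mathbb{R}^{n+1}_+,\nu_\gamma)}$ is the same with $\sup_{\lambda>0}$ replaced by $\liminf_{\lambda\to0^+}$ if $\gamma>0$ and by $\limsup_{\lambda\to\infty}$ if $\gamma<0$. Finally $$\|f\|_{\mathcal{O}^p(\mathbb{R}^n,\mathcal{D}')}=\Big(\sup_{\lambda>0}\lambda^p\sum_{Q\in\mathcal{D}',\,O(f,Q)>\lambda}\ell(Q)^{-p}|Q|\Big)^{1/p},$$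 and $\|f\|_{\mathcal{O}^p(\mathbb{R}^n)}$ is the case $\mathcal{D}'=\mathcal{D}$. *)

theory Defs
  imports "HOL-Analysis.Analysis"
begin

definition half_cube :: "real ^ 'n \<Rightarrow> real \<Rightarrow> (real ^ 'n) set" where
  "half_cube a s = {x. \<forall>i. a $ i \<le> x $ i \<and> x $ i < a $ i + s}"

definition is_cube :: "(real ^ 'n) set \<Rightarrow> bool" where
  "is_cube Q \<longleftrightarrow> (\<exists>a s. 0 < s \<and> Q = half_cube a s)"

text \<open>Well defined on cubes by \<open>sidelength_half_cube\<close> below; junk on other sets.\<close>

definition sidelength :: "(real ^ 'n) set \<Rightarrow> real" where
  "sidelength Q = (THE s. 0 < s \<and> (\<exists>a. Q = half_cube a s))"

definition children :: "(real ^ 'n) set \<Rightarrow> (real ^ 'n) set set" where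
  "children Q = {half_cube (a + (s / 2) *\<^sub>R e) (s / 2) | a s e.
     0 < s \<and> Q = half_cube a s \<and> (\<forall>i. e $ i \<in> {0, 1})}"

text \<open>The side lengths occurring in a system are not prescribed; the partition clause is about
  those that do occur. The empty collection is excluded since it does not cover the space.\<close>

definition dyadic_system :: "(real ^ 'n) set set \<Rightarrow> bool" where
  "dyadic_system D \<longleftrightarrow>
     D \<noteq> {} \<and>
     (\<forall>Q\<in>D. is_cube Q) \<and>
     (\<forall>P\<in>D. \<forall>Q\<in>D. P \<inter> Q = {} \<or> P \<subseteq> Q \<or> Q \<subseteq> P) \<and>
     (\<forall>Q\<in>D. children Q \<subseteq> D) \<and>
     (\<forall>Q\<in>D. \<exists>P\<in>D. Q \<in> children P) \<and>
     (\<forall>s \<in> sidelength ` D. partition_on UNIV {Q \<in> D. sidelength Q = s})"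

definition std_dyadic :: "(real ^ 'n) set set" where
  "std_dyadic = {half_cube (\<chi> i. of_int (j i) * 2 powi k) (2 powi k) |
     (j :: 'n \<Rightarrow> int) (k :: int). True}"

definition radon_measure :: "(real ^ 'n) measure \<Rightarrow> bool" where
  "radon_measure \<mu> \<longleftrightarrow>
     sets \<mu> = sets borel \<and>
     (\<forall>K. compact K \<longrightarrow> emeasure \<mu> K < \<infinity>) \<and>
     (\<forall>E \<in> sets borel. emeasure \<mu> E = (INF U \<in> {U. open U \<and> E \<subseteq> U}. emeasure \<mu> U)) \<and>
     (\<forall>U. open U \<longrightarrow> emeasure \<mu> U = (SUP K \<in> {K. compact K \<and> K \<subseteq> U}. emeasure \<mu> K))"

definition doubling_measure :: "(real ^ 'n) measure \<Rightarrow> bool" where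
  "doubling_measure \<mu> \<longleftrightarrow>
     (\<exists>C::real. \<forall>x r. 0 < r \<longrightarrow>
        0 < emeasure \<mu> (ball x (2 * r)) \<and>
        emeasure \<mu> (ball x (2 * r)) \<le> ennreal C * emeasure \<mu> (ball x r))"

definition locally_integrable ::
    "(real ^ 'n) measure \<Rightarrow> (real ^ 'n \<Rightarrow> 'b::{banach, second_countable_topology}) \<Rightarrow> bool" where
  "locally_integrable \<mu> f \<longleftrightarrow> (\<forall>K. compact K \<longrightarrow> set_integrable \<mu> K f)"

definition avg ::
    "(real ^ 'n) measure \<Rightarrow> (real ^ 'n \<Rightarrow> 'b) \<Rightarrow> (real ^ 'n) set \<Rightarrow> 'b::{banach, second_countable_topology}"
    where
  "avg \<mu> f E = (LINT x:E|\<mu>. f x) /\<^sub>R measure \<mu> E"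

definition osc ::
    "(real ^ 'n \<Rightarrow> 'b::{banach, second_countable_topology}) \<Rightarrow> (real ^ 'n) set \<Rightarrow> real" where
  "osc f E = avg lborel (\<lambda>x. norm (f x - avg lborel f E)) E"

definition nu :: "(real ^ 'n) measure \<Rightarrow> real \<Rightarrow> ((real ^ 'n) \<times> real) measure" where
  "nu \<mu> \<gamma> = density (\<mu> \<Otimes>\<^sub>M restrict_space lborel {0<..}) (\<lambda>(x, t). ennreal (1 / t powr (1 + \<gamma>)))"

text \<open>The library has no power of \<^typ>\<open>ennreal\<close> with real exponent. Powers in \<open>[0, \<infinity>]\<close>, for positive exponents only.\<close>

definition enn_powr :: "ennreal \<Rightarrow> real \<Rightarrow> ennreal" where
  "enn_powr x r = (if x = \<infinity> then \<infinity> else ennreal (enn2real x powr r))"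

text \<open>The regime in which the weak-type condition is tested at its endpoint: \<open>l \<rightarrow> 0\<close> if \<open>\<gamma> > 0\<close>,
  \<open>l \<rightarrow> \<infinity>\<close> if \<open>\<gamma> < 0\<close>; only used for \<open>\<gamma> \<noteq> 0\<close>.\<close>

definition endpoint_lim :: "real \<Rightarrow> (real \<Rightarrow> ennreal) \<Rightarrow> ennreal" where
  "endpoint_lim \<gamma> \<phi> = (if 0 < \<gamma> then Liminf (at_right 0) \<phi> else Limsup at_top \<phi>)"

definition seq_distr ::
    "real \<Rightarrow> (real ^ 'n) measure \<Rightarrow> (real ^ 'n) set set \<Rightarrow> ((real ^ 'n) set \<Rightarrow> real) \<Rightarrow> real \<Rightarrow> ennreal"
    where
  "seq_distr \<gamma> \<mu> D a l =
     (\<Sum>\<^sub>\<infinity>Q \<in> {Q \<in> D. \<bar>a Q\<bar> > l}. ennreal (sidelength Q powr (- \<gamma>)) * emeasure \<mu> Q)"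

definition seq_weak_norm ::
    "real \<Rightarrow> real \<Rightarrow> (real ^ 'n) measure \<Rightarrow> (real ^ 'n) set set \<Rightarrow> ((real ^ 'n) set \<Rightarrow> real) \<Rightarrow> ennreal"
    where
  "seq_weak_norm p \<gamma> \<mu> D a =
     enn_powr (SUP l\<in>{0<..}. ennreal (l powr p) * seq_distr \<gamma> \<mu> D a l) (1 / p)"

definition seq_weak_lim ::
    "real \<Rightarrow> real \<Rightarrow> (real ^ 'n) measure \<Rightarrow> (real ^ 'n) set set \<Rightarrow> ((real ^ 'n) set \<Rightarrow> real) \<Rightarrow> ennreal"
    where
  "seq_weak_lim p \<gamma> \<mu> D a =
     enn_powr (endpoint_lim \<gamma> (\<lambda>l. ennreal (l powr p) * seq_distr \<gamma> \<mu> D a l)) (1 / p)"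

definition fun_distr ::
    "real \<Rightarrow> (real ^ 'n) measure \<Rightarrow> ((real ^ 'n) \<times> real \<Rightarrow> real) \<Rightarrow> real \<Rightarrow> ennreal" where
  "fun_distr \<gamma> \<mu> F l = emeasure (nu \<mu> \<gamma>) {z \<in> space (nu \<mu> \<gamma>). \<bar>F z\<bar> > l}"

definition fun_weak_norm ::
    "real \<Rightarrow> real \<Rightarrow> (real ^ 'n) measure \<Rightarrow> ((real ^ 'n) \<times> real \<Rightarrow> real) \<Rightarrow> ennreal" where
  "fun_weak_norm p \<gamma> \<mu> F =
     enn_powr (SUP l\<in>{0<..}. ennreal (l powr p) * fun_distr \<gamma> \<mu> F l) (1 / p)"

definition fun_weak_lim ::
    "real \<Rightarrow> real \<Rightarrow> (real ^ 'n) measure \<Rightarrow> ((real ^ 'n) \<times> real \<Rightarrow> real) \<Rightarrow> ennreal" where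
  "fun_weak_lim p \<gamma> \<mu> F =
     enn_powr (endpoint_lim \<gamma> (\<lambda>l. ennreal (l powr p) * fun_distr \<gamma> \<mu> F l)) (1 / p)"

definition osc_norm ::
    "real \<Rightarrow> (real ^ 'n) set set \<Rightarrow> (real ^ 'n \<Rightarrow> 'b::{banach, second_countable_topology}) \<Rightarrow> ennreal"
    where
  "osc_norm p D f =
     enn_powr (SUP l\<in>{0<..}. ennreal (l powr p) *
       (\<Sum>\<^sub>\<infinity>Q \<in> {Q \<in> D. osc f Q > l}. ennreal (sidelength Q powr (- p)) * emeasure lborel Q)) (1 / p)"

definition a_seq :: "real \<Rightarrow> real \<Rightarrow> (real ^ 'n) measure \<Rightarrow> (real ^ 'n \<Rightarrow> real) \<Rightarrow> (real ^ 'n) set \<Rightarrow> real"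
    where
  "a_seq p \<gamma> \<mu> f Q = sidelength Q powr (\<gamma> / p) * avg \<mu> f Q"

definition a_fun :: "real \<Rightarrow> real \<Rightarrow> (real ^ 'n) measure \<Rightarrow> (real ^ 'n \<Rightarrow> real) \<Rightarrow> (real ^ 'n) \<times> real \<Rightarrow> real"
    where
  "a_fun p \<gamma> \<mu> f = (\<lambda>(x, t). t powr (\<gamma> / p) * avg \<mu> f (ball x t))"

definition b_seq ::
    "real \<Rightarrow> real \<Rightarrow> (real ^ 'n \<Rightarrow> 'b::{banach, second_countable_topology}) \<Rightarrow> (real ^ 'n) set \<Rightarrow> real"
    where
  "b_seq p \<gamma> f Q = sidelength Q powr (\<gamma> / p) * osc f Q"

definition b_fun ::
    "real \<Rightarrow> real \<Rightarrow> (real ^ 'n \<Rightarrow> 'b::{banach, second_countable_topology}) \<Rightarrow> (real ^ 'n) \<times> real \<Rightarrow> real"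
    where
  "b_fun p \<gamma> f = (\<lambda>(x, t). t powr (\<gamma> / p) * osc f (ball x t))"

definition m_fun ::
    "(real ^ 'n \<Rightarrow> 'b::{banach, second_countable_topology}) \<Rightarrow> (real ^ 'n) \<times> real \<Rightarrow> real" where
  "m_fun f = (\<lambda>(x, r). osc f (ball x r))"

text \<open>The systems are \<open>D j\<close> for \<open>1 \<le> j \<le> n + 1\<close>, where \<open>n = CARD('n)\<close>; other values of \<open>D\<close> are
  irrelevant.\<close>

definition ball_covering_family :: "(nat \<Rightarrow> (real ^ 'n) set set) \<Rightarrow> bool" where
  "ball_covering_family D \<longleftrightarrow>
     (\<forall>j \<in> {1..CARD('n) + 1}. dyadic_system (D j)) \<and>
     (\<exists>C::real. \<forall>x r. 0 < r \<longrightarrow>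
        (\<exists>j \<in> {1..CARD('n) + 1}. \<exists>Q \<in> D j.
           ball x r \<subseteq> Q \<and> measure lborel Q \<le> C * measure lborel (ball x r)))"

definition lesssim :: "real \<Rightarrow> ennreal \<Rightarrow> ennreal \<Rightarrow> bool" where
  "lesssim c A B \<longleftrightarrow> A \<le> ennreal c * B"

definition approx :: "real \<Rightarrow> ennreal \<Rightarrow> ennreal \<Rightarrow> bool" where
  "approx c A B \<longleftrightarrow> lesssim c A B \<and> lesssim c B A"

lemma half_cube_sidelength_unique:
  fixes a b :: "real ^ 'n"
  assumes s: "0 < s" and t: "0 < t" and eq: "half_cube a s = half_cube b t"
  shows "s = t"
proof -
  have le: "u \<le> v" if u: "0 < u" and v: "0 < v" and e: "half_cube c u = half_cube d v"
    for c d :: "real ^ 'n" and u v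
  proof (rule ccontr)
    assume "\<not> u \<le> v"
    then have uv: "v < u" by simp
    have "c \<in> half_cube c u" using u by (simp add: half_cube_def)
    then have "c \<in> half_cube d v" using e by simp
    then have "d $ i \<le> c $ i" for i by (simp add: half_cube_def)
    moreover have "(\<chi> i. c $ i + v) \<in> half_cube c u" using uv v by (simp add: half_cube_def)
    then have "(\<chi> i. c $ i + v) \<in> half_cube d v" using e by simp
    then have "c $ i + v < d $ i + v" for i by (simp add: half_cube_def)
    ultimately show False by (meson add_less_cancel_right not_le)
  qed
  show ?thesis using le[OF s t eq] le[OF t s eq[symmetric]] by simp
qed

lemma sidelength_half_cube: "0 < s \<Longrightarrow> sidelength (half_cube a s) = s"
  unfolding sidelength_def by (rule the_equality) (auto dest: half_cube_sidelength_unique)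

end

theory Submission
  imports Defs
begin

text \<open>Write \<open>F\<close> for one of the functions on the upper half-space, \<open>s\<close> for the corresponding
  sequence on cubes, \<open>n\<close> for the dimension and \<open>\<ell>\<close> for the side length of \<open>Q\<close>.

  To a dyadic cube \<open>Q\<close> attach the cylinder \<open>Q \<times> (n\<ell>, 2n\<ell>)\<close>. These cylinders are pairwise disjoint
  and have \<open>\<nu>\<^sub>\<gamma>\<close>-measure comparable to \<open>\<ell>\<^sup>-\<^sup>\<gamma> \<mu>(Q)\<close>. For \<open>(x, t)\<close> in the cylinder, \<open>B(x, t)\<close>
  contains \<open>Q\<close> and has comparable measure, so \<open>s(Q) \<le> K F(x, t)\<close>; summing over the
  cubes with \<open>s(Q) > \<lambda>\<close> bounds the sum by a multiple of \<open>\<nu>\<^sub>\<gamma>{F > \<lambda> / K}\<close>.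

  Conversely, every \<open>(x, t)\<close> has a cube \<open>Q\<close> with \<open>\<ell>\<close> comparable to \<open>t\<close>, at distance at most
  a multiple of \<open>\<ell>\<close> from \<open>x\<close>, such that \<open>F(x, t) \<le> K s(Q)\<close>. For averages it is found among the
  dyadic cubes meeting \<open>B(x, t)\<close>, for oscillations it is a cube of the covering family that contains
  \<open>B(x, t)\<close>. So \<open>{F > \<lambda>}\<close> is covered by cylinders over enlarged cubes with \<open>s(Q) > \<lambda> / K\<close>,
  whose measures are again comparable to \<open>\<ell>\<^sup>-\<^sup>\<gamma> \<mu>(Q)\<close> by doubling.\<close>

section \<open>Weak-type quantities\<close>

lemma enn_powr_mono:
  assumes "x \<le> y" "0 \<le> r"
  shows "enn_powr x r \<le> enn_powr y r"
proof (cases "y = \<infinity>")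
  case False
  then have "y < top" by (simp add: less_top)
  moreover then have "x < top" using assms by (auto intro: le_less_trans)
  ultimately show ?thesis
    using assms by (auto simp: enn_powr_def intro!: ennreal_leI powr_mono2 enn2real_mono)
qed (auto simp: enn_powr_def)

lemma enn_powr_cmult:
  assumes "0 < c" "0 < r"
  shows "enn_powr (ennreal c * x) r = ennreal (c powr r) * enn_powr x r"
proof (cases "x = \<infinity>")
  case True
  then show ?thesis using assms by (simp add: enn_powr_def ennreal_mult_top)
next
  case False
  moreover from this have "ennreal c * x \<noteq> \<infinity>"
    using assms by (auto simp: ennreal_mult_eq_top_iff)
  ultimately show ?thesis
    using assms by (simp add: enn_powr_def enn2real_mult powr_mult ennreal_mult)
qed

lemma enn_powr_le_cmult:
  assumes "x \<le> ennreal c * y" "0 < c" "0 < r"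
  shows "enn_powr x r \<le> ennreal (c powr r) * enn_powr y r"
  using enn_powr_mono[OF assms(1), of r] assms by (simp add: enn_powr_cmult)

text \<open>Since \<open>l powr p = K powr p * (l / K) powr p\<close>, passing from level
  \<open>l\<close> to level \<open>l / K\<close> costs only the factor
  \<open>K powr p\<close>.\<close>

lemma distr_rescale:
  assumes "0 < K" "0 < l" "u \<le> ennreal C * v"
  shows "ennreal (l powr p) * u \<le> ennreal (C * K powr p) * (ennreal ((l / K) powr p) * v)"
proof -
  have "ennreal (l powr p) = ennreal (K powr p) * ennreal ((l / K) powr p)"
    using assms by (simp add: powr_divide ennreal_mult[symmetric])
  moreover have "ennreal (C * K powr p) = ennreal C * ennreal (K powr p)"
    using assms by (simp add: ennreal_mult'')
  moreover have "ennreal (l powr p) * u \<le> ennreal (l powr p) * (ennreal C * v)"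
    using assms by (intro mult_left_mono) auto
  ultimately show ?thesis
    by (simp add: ac_simps)
qed

text \<open>The supremum runs over all positive levels, and \<open>l / K\<close> is again one of
  them.\<close>

lemma weak_sup_rescale:
  assumes "0 < K" and le: "\<And>l. 0 < l \<Longrightarrow> \<phi> l \<le> ennreal C * \<psi> (l / K)"
  shows "(SUP l\<in>{0<..}. ennreal (l powr p) * \<phi> l) \<le>
    ennreal (C * K powr p) * (SUP l\<in>{0<..}. ennreal (l powr p) * \<psi> l)"
proof (rule SUP_least)
  fix l :: real assume "l \<in> {0<..}"
  then have l: "0 < l" by simp
  show "ennreal (l powr p) * \<phi> l \<le>
    ennreal (C * K powr p) * (SUP l\<in>{0<..}. ennreal (l powr p) * \<psi> l)"
    using distr_rescale[OF assms(1) l le[OF l]]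
    by (rule order_trans) (use assms l in \<open>intro mult_left_mono SUP_upper; auto\<close>)
qed

text \<open>Multiplication by a finite constant is continuous and monotone on [0, infinity], so it
  commutes with lower limits along a proper filter.\<close>

lemma Liminf_ennreal_cmult:
  assumes "F \<noteq> bot"
  shows "Liminf F (\<lambda>x. ennreal c * g x) = ennreal c * Liminf F g"
proof -
  have "Liminf F (\<lambda>x. (\<lambda>y. ennreal c * y) (g x)) = (\<lambda>y. ennreal c * y) (Liminf F g)"
    by (rule Liminf_compose_continuous_mono)
      (use assms in \<open>auto intro!: ennreal_continuous_on_cmult continuous_on_id monoI mult_left_mono\<close>)
  then show ?thesis by simp
qed

lemma Limsup_ennreal_cmult:
  assumes "F \<noteq> bot"
  shows "Limsup F (\<lambda>x. ennreal c * g x) = ennreal c * Limsup F g"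
proof -
  have "Limsup F (\<lambda>x. (\<lambda>y. ennreal c * y) (g x)) = (\<lambda>y. ennreal c * y) (Limsup F g)"
    by (rule Limsup_compose_continuous_mono)
      (use assms in \<open>auto intro!: ennreal_continuous_on_cmult continuous_on_id monoI mult_left_mono\<close>)
  then show ?thesis by simp
qed

text \<open>Dilation by \<open>1 / K\<close> preserves both filters, \<open>at_right 0\<close> and
  \<open>at_top\<close>, so the change of level disappears in the limit and only the constant
  remains.\<close>

lemma endpoint_lim_rescale:
  assumes K: "0 < K" and le: "\<And>l. 0 < l \<Longrightarrow> \<phi> l \<le> ennreal C * \<psi> (l / K)"
  shows "endpoint_lim \<gamma> (\<lambda>l. ennreal (l powr p) * \<phi> l) \<le>
    ennreal (C * K powr p) * endpoint_lim \<gamma> (\<lambda>l. ennreal (l powr p) * \<psi> l)"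
proof -
  define h where "h l = ennreal (l powr p) * \<psi> l" for l
  define C' where "C' = C * K powr p"
  have ev: "ennreal (l powr p) * \<phi> l \<le> ennreal C' * h (1 / K * l)" if "0 < l" for l
    using distr_rescale[OF K that le[OF that], of p] by (simp add: h_def C'_def)
  show ?thesis
  proof (cases "0 < \<gamma>")
    case True
    have "Liminf (at_right 0) (\<lambda>l. ennreal (l powr p) * \<phi> l)
        \<le> Liminf (at_right 0) (\<lambda>l. ennreal C' * h (1 / K * l))"
      by (rule Liminf_mono) (use ev in \<open>auto simp: eventually_at_right_field intro!: exI[of _ 1]\<close>)
    also have "\<dots> = ennreal C' * Liminf (at_right 0) (\<lambda>l. h (1 / K * l))"
      by (rule Liminf_ennreal_cmult) simp
    also have "Liminf (at_right 0) (\<lambda>l. h (1 / K * l))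
        \<le> Liminf (filtermap (\<lambda>l. 1 / K * l) (at_right 0)) h"
      by (rule Liminf_filtermap_ge) (use K in \<open>auto simp: inj_def\<close>)
    also have "filtermap ((*) (1 / K)) (at_right 0) = at_right 0"
      using filtermap_times_pos_at_right[of "1 / K" 0] K by simp
    finally show ?thesis
      using True by (simp add: endpoint_lim_def C'_def h_def[abs_def] mult_left_mono)
  next
    case False
    have lim: "filterlim (\<lambda>l. 1 / K * l) at_top at_top"
      by (rule filterlim_tendsto_pos_mult_at_top[OF tendsto_const]) (use K in \<open>auto intro: filterlim_ident\<close>)
    have "Limsup at_top (\<lambda>l. ennreal (l powr p) * \<phi> l)
        \<le> Limsup at_top (\<lambda>l. ennreal C' * h (1 / K * l))"
      by (rule Limsup_mono) (use ev in \<open>auto intro: eventually_mono[OF eventually_gt_at_top[of 0]]\<close>)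
    also have "\<dots> = ennreal C' * Limsup at_top (\<lambda>l. h (1 / K * l))"
      by (rule Limsup_ennreal_cmult) simp
    also have "Limsup at_top (\<lambda>l. h (1 / K * l)) \<le> Limsup (filtermap (\<lambda>l. 1 / K * l) at_top) h"
      by (rule Limsup_filtermap_ge)
    \<comment> \<open>By \<open>lim\<close> the image filter is finer than \<open>at_top\<close>,
      and a finer filter has a smaller upper limit.\<close>
    also have "\<dots> \<le> Limsup at_top h"
      using lim unfolding filterlim_def Limsup_def
      by (intro INF_superset_mono) (auto simp: le_filter_def simp del: eventually_filtermap)
    finally show ?thesis
      using False by (simp add: endpoint_lim_def C'_def h_def[abs_def] mult_left_mono)
  qed
qed

lemma weak_bounds_rescale:
  assumes "0 < p" "0 < C" "0 < K"
    and "\<And>l. 0 < l \<Longrightarrow> \<phi> l \<le> ennreal C * \<psi> (l / K)"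
  shows "enn_powr (SUP l\<in>{0<..}. ennreal (l powr p) * \<phi> l) (1 / p) \<le>
      ennreal ((C * K powr p) powr (1 / p)) *
        enn_powr (SUP l\<in>{0<..}. ennreal (l powr p) * \<psi> l) (1 / p)"
    and "enn_powr (endpoint_lim \<gamma> (\<lambda>l. ennreal (l powr p) * \<phi> l)) (1 / p) \<le>
      ennreal ((C * K powr p) powr (1 / p)) *
        enn_powr (endpoint_lim \<gamma> (\<lambda>l. ennreal (l powr p) * \<psi> l)) (1 / p)"
  using assms
  by (auto intro!: enn_powr_le_cmult weak_sup_rescale endpoint_lim_rescale)

section \<open>Unordered sums in \<open>ennreal\<close> and powers on comparable scales\<close>

text \<open>In \<open>ennreal\<close> an unordered sum is the supremum of its finite partial sums;
  this lemma and the next are the two halves of that fact.\<close>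

lemma sum_le_infsum_ennreal:
  fixes f :: "'i \<Rightarrow> ennreal"
  assumes "finite F" "F \<subseteq> S"
  shows "sum f F \<le> infsum f S"
  using infsum_mono_neutral[of f F f S] assms by (auto simp: nonneg_summable_on_complete)

lemma infsum_le_ennreal:
  fixes f :: "'i \<Rightarrow> ennreal"
  assumes "\<And>F. finite F \<Longrightarrow> F \<subseteq> S \<Longrightarrow> sum f F \<le> c"
  shows "infsum f S \<le> c"
  using assms by (intro infsum_le_finite_sums nonneg_summable_on_complete) auto

text \<open>Continuity from below along finite pieces of an enumeration reduces the claim to finite
  subadditivity.\<close>

lemma emeasure_UN_le_infsum:
  assumes "countable S" "\<And>i. i \<in> S \<Longrightarrow> E i \<in> sets M"
  shows "emeasure M (\<Union>i\<in>S. E i) \<le> (\<Sum>\<^sub>\<infinity>i\<in>S. emeasure M (E i))"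
proof (cases "S = {}")
  case False
  \<comment> \<open>The enumeration may repeat indices; working with its image counts each index
    once, as the unordered sum does.\<close>
  define A where "A n = (\<Union>i\<in>from_nat_into S ` {..<n}. E i)" for n :: nat
  have sub: "from_nat_into S ` {..<n} \<subseteq> S" for n
    using from_nat_into[OF False] by auto
  have "range (from_nat_into S) = S"
    using assms(1) False by (simp add: range_from_nat_into)
  then have "(\<Union>i\<in>S. E i) = (\<Union>n. E (from_nat_into S n))" by (metis image_image)
  also have "\<dots> = (\<Union>n. A n)"
    by (auto simp: A_def intro!: exI[of _ "Suc _"])
  finally have "emeasure M (\<Union>i\<in>S. E i) = emeasure M (\<Union>n. A n)" by simp
  also have "\<dots> = (SUP n. emeasure M (A n))"
    using assms sub by (intro SUP_emeasure_incseq[symmetric] incseq_SucI)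
      (auto simp: A_def intro!: sets.finite_UN intro: less_SucI)
  also have "\<dots> \<le> (\<Sum>\<^sub>\<infinity>i\<in>S. emeasure M (E i))"
  proof (rule SUP_least)
    fix n
    have "emeasure M (A n) \<le> (\<Sum>i\<in>from_nat_into S ` {..<n}. emeasure M (E i))"
      unfolding A_def using sub assms by (intro emeasure_subadditive_finite) auto
    also have "\<dots> \<le> (\<Sum>\<^sub>\<infinity>i\<in>S. emeasure M (E i))"
      using sub by (intro sum_le_infsum_ennreal) auto
    finally show "emeasure M (A n) \<le> (\<Sum>\<^sub>\<infinity>i\<in>S. emeasure M (E i))" .
  qed
  finally show ?thesis .
qed simp

text \<open>The ratio \<open>t / s\<close> stays in a compact interval of positive numbers. A power
  is monotone there, so it is bounded by the sum of its two endpoint values, whatever the sign of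
  the exponent.\<close>

lemma powr_comparable:
  fixes q \<alpha> \<beta> :: real
  assumes "0 < \<alpha>" "\<alpha> < \<beta>"
  obtains K where "0 < K"
    "\<And>s t. 0 < s \<Longrightarrow> \<alpha> * s \<le> t \<Longrightarrow> t \<le> \<beta> * s \<Longrightarrow> t powr q \<le> K * s powr q"
    "\<And>s t. 0 < s \<Longrightarrow> \<alpha> * s \<le> t \<Longrightarrow> t \<le> \<beta> * s \<Longrightarrow> s powr q \<le> K * t powr q"
proof -
  have bd: "u powr r \<le> \<alpha> powr r + \<beta> powr r" if "\<alpha> \<le> u" "u \<le> \<beta>" for u r :: real
  proof (cases "0 \<le> r")
    case True
    then have "u powr r \<le> \<beta> powr r" using that assms by (intro powr_mono2) auto
    then show ?thesis by (smt (verit) powr_ge_zero)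
  next
    case False
    then have "u powr r \<le> \<alpha> powr r" using that assms by (intro powr_mono2') auto
    then show ?thesis by (smt (verit) powr_ge_zero)
  qed
  \<comment> \<open>Exponent \<open>q\<close> serves the first inequality and \<open>- q\<close> the
    second; adding the bounds gives one constant for both.\<close>
  define K where "K = (\<alpha> powr q + \<beta> powr q) + (\<alpha> powr (- q) + \<beta> powr (- q))"
  have pos: "0 < \<alpha> powr r + \<beta> powr r" for r using assms by (simp add: add_pos_pos)
  show ?thesis
  proof (rule that)
    show "0 < K" using pos[of q] pos[of "- q"] by (simp add: K_def)
  next
    fix s t :: real assume st: "0 < s" "\<alpha> * s \<le> t" "t \<le> \<beta> * s"
    from st assms have t: "0 < t" by (smt (verit) mult_pos_pos)
    have u: "\<alpha> \<le> t / s" "t / s \<le> \<beta>" using st by (auto simp: field_simps)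
    have "(t / s) powr q \<le> K" "(t / s) powr (- q) \<le> K"
      using bd[OF u, of q] bd[OF u, of "- q"] pos[of q] pos[of "- q"] by (auto simp: K_def)
    then show "t powr q \<le> K * s powr q" "s powr q \<le> K * t powr q"
      using st t by (auto simp: powr_divide powr_minus field_simps)
  qed
qed

section \<open>Cubes and doubling measures\<close>

lemma is_cubeE:
  assumes "is_cube Q"
  obtains a where "0 < sidelength Q" "Q = half_cube a (sidelength Q)"
  using assms by (auto simp: is_cube_def sidelength_half_cube)

lemma sidelength_pos: "is_cube Q \<Longrightarrow> 0 < sidelength Q"
  by (auto elim: is_cubeE)

lemma half_cube_borel: "half_cube a s \<in> sets borel"
  unfolding half_cube_def by measurable

lemma cube_borel: "is_cube Q \<Longrightarrow> Q \<in> sets borel"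
  by (auto simp: is_cube_def half_cube_borel)

text \<open>The Euclidean norm is at most the sum of the absolute coordinates, which makes the
  dimension a convenient diameter constant. Strictness comes from the cube being half-open.\<close>

lemma dist_half_cube:
  fixes x y :: "real ^ 'n"
  assumes "x \<in> half_cube a s" "y \<in> half_cube a s"
  shows "dist x y < of_nat CARD('n) * s"
proof -
  have "dist x y \<le> (\<Sum>i\<in>UNIV. \<bar>(x - y) $ i\<bar>)"
    unfolding dist_norm by (rule norm_le_l1_cart)
  also have "\<dots> < (\<Sum>i\<in>(UNIV :: 'n set). s)"
  proof (rule sum_strict_mono)
    fix i
    have "a $ i \<le> x $ i" "x $ i < a $ i + s" "a $ i \<le> y $ i" "y $ i < a $ i + s"
      using assms by (auto simp: half_cube_def)
    then show "\<bar>(x - y) $ i\<bar> < s" by auto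
  qed auto
  finally show ?thesis by simp
qed

lemma dist_cube:
  fixes Q :: "(real ^ 'n) set"
  assumes "is_cube Q" "x \<in> Q" "y \<in> Q"
  shows "dist x y < of_nat CARD('n) * sidelength Q"
  using assms by (metis is_cubeE dist_half_cube)

text \<open>The ball is inscribed at the centre of the cube. Through it the doubling condition,
  which speaks of balls, becomes applicable to cubes.\<close>

lemma cube_contains_ball:
  fixes Q :: "(real ^ 'n) set"
  assumes "is_cube Q"
  obtains c where "ball c (sidelength Q / 2) \<subseteq> Q" "c \<in> Q"
proof -
  obtain a where a: "0 < sidelength Q" "Q = half_cube a (sidelength Q)"
    using assms by (rule is_cubeE)
  define s where "s = sidelength Q"
  define c where "c = (\<chi> i. a $ i + s / 2)"
  have "x \<in> half_cube a s" if "dist c x < s / 2" for x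
  proof -
    have "\<bar>(c - x) $ i\<bar> < s / 2" for i
      using component_le_norm_cart[of "c - x" i] that by (simp add: dist_norm)
    then have "\<bar>a $ i + s / 2 - x $ i\<bar> < s / 2" for i by (simp add: c_def)
    then have "a $ i \<le> x $ i \<and> x $ i < a $ i + s" for i by (smt (verit) field_sum_of_halves)
    then show ?thesis by (simp add: half_cube_def)
  qed
  then have "ball c (s / 2) \<subseteq> Q" using a by (auto simp: s_def)
  moreover from this have "c \<in> Q" using a by (auto simp: s_def)
  ultimately show ?thesis using that by (auto simp: s_def)
qed

section \<open>Standard dyadic cubes\<close>

lemma std_dyadicE:
  fixes Q :: "(real ^ 'n) set"
  assumes "Q \<in> std_dyadic"
  obtains j :: "'n \<Rightarrow> int" and k :: int
  where "Q = half_cube (\<chi> i. of_int (j i) * 2 powi k) (2 powi k)" "sidelength Q = 2 powi k"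
  using assms by (auto simp: std_dyadic_def sidelength_half_cube)

lemma std_dyadic_is_cube: "Q \<in> std_dyadic \<Longrightarrow> is_cube Q"
  by (auto simp: std_dyadic_def is_cube_def intro!: exI[of _ "2 powi _"])

text \<open>The index of the cube through a point is forced coordinatewise to be a floor. This gives
  both existence and uniqueness of the cube of a given generation through a point.\<close>

lemma std_dyadic_mem_iff:
  fixes x :: "real ^ 'n"
  shows "x \<in> half_cube (\<chi> i. of_int (j i) * 2 powi k) (2 powi k) \<longleftrightarrow> (\<forall>i. j i = \<lfloor>x $ i / 2 powi k\<rfloor>)"
proof -
  have "(0::real) < 2 powi k" by simp
  then show ?thesis
    by (auto simp: half_cube_def floor_eq_iff eq_commute[of "j _"] field_simps)
qed

lemma std_dyadic_eq:
  assumes "P \<in> std_dyadic" "Q \<in> std_dyadic" "sidelength P = sidelength Q" "x \<in> P" "x \<in> Q"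
  shows "P = Q"
proof -
  obtain i k where P: "P = half_cube (\<chi> m. of_int (i m) * 2 powi k) (2 powi k)" "sidelength P = 2 powi k"
    using assms(1) by (rule std_dyadicE)
  obtain j l where Q: "Q = half_cube (\<chi> m. of_int (j m) * 2 powi l) (2 powi l)" "sidelength Q = 2 powi l"
    using assms(2) by (rule std_dyadicE)
  have "(2::real) powi k = 2 powi l" using P Q assms by simp
  with P Q assms(4,5) std_dyadic_mem_iff[of x i k] std_dyadic_mem_iff[of x j l]
  have "i = j" by auto
  then show ?thesis using P Q \<open>(2::real) powi k = 2 powi l\<close> by simp
qed

text \<open>Side lengths are integer powers of 2, so distinct ones differ at least by a factor 2.
  This separates the heights of cylinders of different generations.\<close>

lemma std_dyadic_sidelength_less:
  assumes "P \<in> std_dyadic" "Q \<in> std_dyadic" "sidelength P < sidelength Q"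
  shows "2 * sidelength P \<le> sidelength Q"
proof -
  obtain k where k: "sidelength P = 2 powi k" using assms(1) by (auto elim: std_dyadicE)
  obtain l where l: "sidelength Q = 2 powi l" using assms(2) by (auto elim: std_dyadicE)
  have "k < l"
    using assms(3) power_int_increasing[of l k "2::real"] unfolding k l by (rule_tac ccontr) auto
  then have "(2::real) powi (k + 1) \<le> 2 powi l" by (intro power_int_increasing) auto
  then show ?thesis by (simp add: k l power_int_add)
qed

text \<open>Being a union of open balls, this enlargement is open although the cube is half-open, as
  the Lindelof argument below requires.\<close>

definition nbhd :: "real \<Rightarrow> (real ^ 'n) set \<Rightarrow> (real ^ 'n) set" where
  "nbhd \<beta> Q = (\<Union>y\<in>Q. ball y (\<beta> * sidelength Q))"

lemma open_nbhd: "open (nbhd \<beta> Q)"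
  by (auto simp: nbhd_def)

lemma nbhd_borel: "nbhd \<beta> Q \<in> sets borel"
  by (simp add: open_nbhd)

lemma sets_nu: "sets (nu \<mu> \<gamma>) = sets (\<mu> \<Otimes>\<^sub>M restrict_space lborel {0<..})"
  by (simp add: nu_def)

lemma snd_nu_measurable [measurable]: "snd \<in> borel_measurable (\<mu> \<Otimes>\<^sub>M restrict_space lborel {0::real<..})"
  by (rule measurable_compose[OF measurable_snd]) (auto intro: measurable_restrict_space1)

section \<open>Doubling measures on balls and cubes\<close>

text \<open>Collects what doubling Radon measures and Lebesgue measure have in common, so that
  averages and oscillations share the comparison results below.\<close>

locale doubling_space =
  fixes \<mu> :: "(real ^ 'n) measure"
  assumes sets_eq [measurable_cong]: "sets \<mu> = sets borel"
    and ball_finite: "emeasure \<mu> (ball x r) < \<infinity>"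
    and doubling: "doubling_measure \<mu>"
begin

lemma space_eq: "space \<mu> = UNIV"
  using sets_eq_imp_space_eq[OF sets_eq] by simp

lemma borel_sets [simp]: "A \<in> sets borel \<Longrightarrow> A \<in> sets \<mu>"
  by (simp add: sets_eq)

lemma space_nu: "space (nu \<mu> \<gamma>) = UNIV \<times> {0<..}"
  by (auto simp: nu_def space_pair_measure space_eq space_restrict_space)

text \<open>The doubling condition asserts positivity for the ball of radius \<open>2 * r\<close>,
  so it is applied at half the radius.\<close>

lemma ball_pos: "0 < r \<Longrightarrow> 0 < emeasure \<mu> (ball x r)"
  using doubling unfolding doubling_measure_def by (metis half_gt_zero field_sum_of_halves mult_2)

lemma finite_of_subset_ball: "A \<subseteq> ball x r \<Longrightarrow> emeasure \<mu> A < \<infinity>"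
  using emeasure_mono[of A "ball x r" \<mu>] ball_finite[of x r] by (auto intro: le_less_trans)

lemma sigma_finite: "sigma_finite_measure \<mu>"
proof
  show "\<exists>A. countable A \<and> A \<subseteq> sets \<mu> \<and> \<Union>A = space \<mu> \<and> (\<forall>a\<in>A. emeasure \<mu> a \<noteq> \<infinity>)"
  proof (intro exI conjI)
    show "countable (range (\<lambda>n::nat. ball 0 (real n) :: (real ^ 'n) set))" by simp
    show "\<Union> (range (\<lambda>n::nat. ball 0 (real n))) = space \<mu>"
      using reals_Archimedean2 by (auto simp: space_eq)
  qed (use ball_finite in \<open>auto simp: less_top\<close>)
qed

text \<open>Doubling is iterated \<open>k\<close> times, where
  \<open>\<beta> < 2 ^ k\<close>.\<close>

lemma ball_comparable:
  obtains K where "0 < K"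
    "\<And>x r. 0 < r \<Longrightarrow> emeasure \<mu> (ball x (\<beta> * r)) \<le> ennreal K * emeasure \<mu> (ball x r)"
proof -
  obtain C where C: "\<And>x r. 0 < r \<Longrightarrow> emeasure \<mu> (ball x (2 * r)) \<le> ennreal C * emeasure \<mu> (ball x r)"
    using doubling unfolding doubling_measure_def by blast
  \<comment> \<open>The doubling constant is just some real number; raising it to at least 1 makes
    its powers positive and lets \<open>ennreal\<close> respect their products.\<close>
  define C' where "C' = max C 1"
  have pow: "emeasure \<mu> (ball x (2 ^ k * r)) \<le> ennreal (C' ^ k) * emeasure \<mu> (ball x r)"
    if "0 < r" for k x r
  proof (induction k)
    case (Suc k)
    have "emeasure \<mu> (ball x (2 ^ Suc k * r)) \<le> ennreal C * emeasure \<mu> (ball x (2 ^ k * r))"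
      using C[of "2 ^ k * r" x] that by (simp add: ac_simps)
    also have "\<dots> \<le> ennreal C' * (ennreal (C' ^ k) * emeasure \<mu> (ball x r))"
      using Suc by (intro mult_mono) (auto simp: C'_def intro!: ennreal_leI)
    also have "\<dots> = ennreal (C' ^ Suc k) * emeasure \<mu> (ball x r)"
      by (simp add: ennreal_mult C'_def mult.assoc)
    finally show ?case .
  qed simp
  obtain k where k: "\<beta> < 2 ^ k" using real_arch_pow[of 2 \<beta>] by auto
  show ?thesis
  proof (rule that)
    show "0 < C' ^ k" by (simp add: C'_def)
    fix x and r :: real assume "0 < r"
    then have "emeasure \<mu> (ball x (\<beta> * r)) \<le> emeasure \<mu> (ball x (2 ^ k * r))"
      using k by (intro emeasure_mono subset_ball mult_right_mono) auto
    also have "\<dots> \<le> ennreal (C' ^ k) * emeasure \<mu> (ball x r)" using pow \<open>0 < r\<close> .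
    finally show "emeasure \<mu> (ball x (\<beta> * r)) \<le> ennreal (C' ^ k) * emeasure \<mu> (ball x r)" .
  qed
qed

lemma cube_finite:
  assumes "is_cube Q"
  shows "emeasure \<mu> Q < \<infinity>"
proof -
  obtain c where "ball c (sidelength Q / 2) \<subseteq> Q" "c \<in> Q" using assms by (rule cube_contains_ball)
  then have "Q \<subseteq> ball c (of_nat CARD('n) * sidelength Q)" using dist_cube[OF assms] by auto
  then show ?thesis by (rule finite_of_subset_ball)
qed

lemma cube_pos:
  assumes "is_cube Q"
  shows "0 < emeasure \<mu> Q"
proof -
  obtain c where "ball c (sidelength Q / 2) \<subseteq> Q" using assms by (rule cube_contains_ball)
  then have "emeasure \<mu> (ball c (sidelength Q / 2)) \<le> emeasure \<mu> Q"
    using cube_borel[OF assms] by (intro emeasure_mono) auto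
  with ball_pos[of "sidelength Q / 2" c] sidelength_pos[OF assms] show ?thesis by simp
qed

text \<open>If \<open>c\<close> is the centre of the inscribed ball, of radius half the side length,
  then the neighbourhood lies within \<open>n + \<beta>\<close> side lengths of \<open>c\<close>,
  where \<open>n\<close> is the dimension. The ratio of the two radii is the dilation factor
  \<open>2 * (n + \<beta>)\<close>.\<close>

lemma nbhd_comparable:
  obtains K where "0 < K"
    "\<And>Q. is_cube Q \<Longrightarrow> emeasure \<mu> (nbhd \<beta> Q) \<le> ennreal K * emeasure \<mu> Q"
proof -
  obtain K where K: "0 < K" "\<And>x r. 0 < r \<Longrightarrow>
      emeasure \<mu> (ball x ((2 * (of_nat CARD('n) + \<beta>)) * r)) \<le> ennreal K * emeasure \<mu> (ball x r)"
    by (rule ball_comparable[of "2 * (of_nat CARD('n) + \<beta>)"]) blast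
  show ?thesis
  proof (rule that[OF K(1)])
    fix Q :: "(real ^ 'n) set" assume Q: "is_cube Q"
    then obtain c where c: "ball c (sidelength Q / 2) \<subseteq> Q" "c \<in> Q" by (rule cube_contains_ball)
    have "nbhd \<beta> Q \<subseteq> ball c ((2 * (of_nat CARD('n) + \<beta>)) * (sidelength Q / 2))"
    proof
      fix x assume "x \<in> nbhd \<beta> Q"
      then obtain y where y: "y \<in> Q" "dist y x < \<beta> * sidelength Q" by (auto simp: nbhd_def)
      then have "dist c x < of_nat CARD('n) * sidelength Q + \<beta> * sidelength Q"
        using dist_cube[OF Q c(2) y(1)] dist_triangle[of c x y] by linarith
      then show "x \<in> ball c ((2 * (of_nat CARD('n) + \<beta>)) * (sidelength Q / 2))"
        by (simp add: algebra_simps)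
    qed
    then have "emeasure \<mu> (nbhd \<beta> Q) \<le> emeasure \<mu> (ball c ((2 * (of_nat CARD('n) + \<beta>)) * (sidelength Q / 2)))"
      by (intro emeasure_mono) auto
    also have "\<dots> \<le> ennreal K * emeasure \<mu> (ball c (sidelength Q / 2))"
      using sidelength_pos[OF Q] by (intro K(2)) simp
    also have "\<dots> \<le> ennreal K * emeasure \<mu> Q"
      using c cube_borel[OF Q] by (intro mult_left_mono emeasure_mono) auto
    finally show "emeasure \<mu> (nbhd \<beta> Q) \<le> ennreal K * emeasure \<mu> Q" .
  qed
qed

section \<open>Measure of cylinders in the upper half-space\<close>

lemma cylinder_sets:
  assumes "U \<in> sets borel" "0 \<le> a"
  shows "U \<times> {a<..<b} \<in> sets (nu \<mu> \<gamma>)"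
  unfolding sets_nu using assms
  by (intro pair_measureI) (auto simp: sets_restrict_space_iff)

text \<open>On the cylinder the density is comparable to \<open>s powr (- 1 - \<gamma>)\<close>, and
  the height is \<open>(\<beta> - \<alpha>) * s\<close>; the product of the two has the order
  \<open>s powr (- \<gamma>)\<close>.\<close>

lemma nu_cylinder:
  fixes \<alpha> \<beta> :: real
  assumes "0 < \<alpha>" "\<alpha> < \<beta>"
  obtains K where "0 < K"
    "\<And>U s. U \<in> sets borel \<Longrightarrow> 0 < s \<Longrightarrow>
      emeasure (nu \<mu> \<gamma>) (U \<times> {\<alpha> * s<..<\<beta> * s}) \<le> ennreal K * (ennreal (s powr (- \<gamma>)) * emeasure \<mu> U)"
    "\<And>U s. U \<in> sets borel \<Longrightarrow> 0 < s \<Longrightarrow>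
      ennreal (s powr (- \<gamma>)) * emeasure \<mu> U \<le> ennreal K * emeasure (nu \<mu> \<gamma>) (U \<times> {\<alpha> * s<..<\<beta> * s})"
proof -
  obtain K where K: "0 < K"
    "\<And>s t. 0 < s \<Longrightarrow> \<alpha> * s \<le> t \<Longrightarrow> t \<le> \<beta> * s \<Longrightarrow> t powr (- 1 - \<gamma>) \<le> K * s powr (- 1 - \<gamma>)"
    "\<And>s t. 0 < s \<Longrightarrow> \<alpha> * s \<le> t \<Longrightarrow> t \<le> \<beta> * s \<Longrightarrow> s powr (- 1 - \<gamma>) \<le> K * t powr (- 1 - \<gamma>)"
    using powr_comparable[OF assms, of "- 1 - \<gamma>"] by blast
  let ?\<rho> = "restrict_space lborel {0::real<..}"
  interpret \<rho>: sigma_finite_measure ?\<rho>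
    by (rule sigma_finite_measure_restrict_space) (auto intro: sigma_finite_lborel)
  \<comment> \<open>The product formula gives the measure of the cylinder without the weight; the
    weight then enters as an integrand that can be estimated pointwise.\<close>
  have prod: "emeasure (\<mu> \<Otimes>\<^sub>M ?\<rho>) (U \<times> {\<alpha> * s<..<\<beta> * s}) = emeasure \<mu> U * ennreal ((\<beta> - \<alpha>) * s)"
    and int: "emeasure (nu \<mu> \<gamma>) (U \<times> {\<alpha> * s<..<\<beta> * s}) =
      (\<integral>\<^sup>+z. ennreal (snd z powr (- 1 - \<gamma>)) * indicator (U \<times> {\<alpha> * s<..<\<beta> * s}) z \<partial>(\<mu> \<Otimes>\<^sub>M ?\<rho>))"
    and meas: "U \<times> {\<alpha> * s<..<\<beta> * s} \<in> sets (\<mu> \<Otimes>\<^sub>M ?\<rho>)"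
    if U: "U \<in> sets borel" "0 < s" for U s
  proof -
    have a: "0 < \<alpha> * s" using assms U by simp
    then have I: "{\<alpha> * s<..<\<beta> * s} \<in> sets ?\<rho>" "{\<alpha> * s<..<\<beta> * s} \<subseteq> {0<..}"
      by (auto simp: sets_restrict_space_iff)
    then have "emeasure ?\<rho> {\<alpha> * s<..<\<beta> * s} = ennreal ((\<beta> - \<alpha>) * s)"
      using assms U by (simp add: emeasure_restrict_space left_diff_distrib)
    then show "emeasure (\<mu> \<Otimes>\<^sub>M ?\<rho>) (U \<times> {\<alpha> * s<..<\<beta> * s}) = emeasure \<mu> U * ennreal ((\<beta> - \<alpha>) * s)"
      using \<rho>.emeasure_pair_measure_Times[of U \<mu>] I U by simp
    show E: "U \<times> {\<alpha> * s<..<\<beta> * s} \<in> sets (\<mu> \<Otimes>\<^sub>M ?\<rho>)"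
      using cylinder_sets[OF U(1), of "\<alpha> * s"] a by (simp add: sets_nu)
    have "emeasure (nu \<mu> \<gamma>) (U \<times> {\<alpha> * s<..<\<beta> * s}) =
      (\<integral>\<^sup>+z. (case z of (x, t) \<Rightarrow> ennreal (1 / t powr (1 + \<gamma>))) * indicator (U \<times> {\<alpha> * s<..<\<beta> * s}) z \<partial>(\<mu> \<Otimes>\<^sub>M ?\<rho>))"
      unfolding nu_def by (rule emeasure_density[OF _ E]) (unfold case_prod_beta, measurable)
    also have "\<dots> = (\<integral>\<^sup>+z. ennreal (snd z powr (- 1 - \<gamma>)) * indicator (U \<times> {\<alpha> * s<..<\<beta> * s}) z \<partial>(\<mu> \<Otimes>\<^sub>M ?\<rho>))"
      by (intro nn_integral_cong) (auto simp: indicator_def powr_minus_divide[symmetric])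
    finally show "emeasure (nu \<mu> \<gamma>) (U \<times> {\<alpha> * s<..<\<beta> * s}) = \<dots>" .
  qed
  have pw: "s powr (- 1 - \<gamma>) * s = s powr (- \<gamma>)" if "0 < s" for s
    using that powr_add[of s "- 1 - \<gamma>" 1] by simp
  have cancel: "(K / d) * ((w / K) * (d * s)) = w * s" if "0 < d" for d w s
    using that K(1) by (simp add: field_simps)
  have ennreal_mult3: "ennreal (a * (b * c)) * X = ennreal a * (ennreal b * (X * ennreal c))"
    if "0 \<le> a" "0 \<le> b" "0 \<le> c" for a b c X
    using that by (simp add: ennreal_mult ac_simps)
  \<comment> \<open>The two summands are the constants of the upper and of the lower
    estimate.\<close>
  define K' where "K' = K * (\<beta> - \<alpha>) + K / (\<beta> - \<alpha>)"
  have le1: "K * (\<beta> - \<alpha>) \<le> K'" and le2: "K / (\<beta> - \<alpha>) \<le> K'" and pos: "0 < K'"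
    using K(1) assms by (auto simp: K'_def add_pos_pos)
  show ?thesis
  proof (rule that[OF pos])
    fix U :: "(real ^ 'n) set" and s :: real assume U: "U \<in> sets borel" "0 < s"
    let ?E = "U \<times> {\<alpha> * s<..<\<beta> * s}"
    have "emeasure (nu \<mu> \<gamma>) ?E \<le> (\<integral>\<^sup>+z. ennreal (K * s powr (- 1 - \<gamma>)) * indicator ?E z \<partial>(\<mu> \<Otimes>\<^sub>M ?\<rho>))"
      unfolding int[OF U] using K(2) U
      by (intro nn_integral_mono) (auto simp: indicator_def intro!: ennreal_leI)
    also have "\<dots> = ennreal (K * s powr (- 1 - \<gamma>)) * (emeasure \<mu> U * ennreal ((\<beta> - \<alpha>) * s))"
      using meas[OF U] prod[OF U] by (simp add: nn_integral_cmult_indicator)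
    also have "\<dots> = ennreal ((K * s powr (- 1 - \<gamma>)) * ((\<beta> - \<alpha>) * s)) * emeasure \<mu> U"
      using K(1) assms U by (simp add: ennreal_mult ac_simps)
    also have "(K * s powr (- 1 - \<gamma>)) * ((\<beta> - \<alpha>) * s) = (K * (\<beta> - \<alpha>)) * (s powr (- \<gamma>))"
      using pw[OF U(2)] by (metis (no_types) mult.assoc mult.left_commute)
    also have "ennreal \<dots> * emeasure \<mu> U \<le> ennreal (K' * s powr (- \<gamma>)) * emeasure \<mu> U"
      using le1 by (intro mult_right_mono ennreal_leI) auto
    also have "\<dots> = ennreal K' * (ennreal (s powr (- \<gamma>)) * emeasure \<mu> U)"
      using pos by (simp add: ennreal_mult mult.assoc)
    finally show "emeasure (nu \<mu> \<gamma>) ?E \<le> ennreal K' * (ennreal (s powr (- \<gamma>)) * emeasure \<mu> U)" .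
  next
    fix U :: "(real ^ 'n) set" and s :: real assume U: "U \<in> sets borel" "0 < s"
    let ?E = "U \<times> {\<alpha> * s<..<\<beta> * s}"
    \<comment> \<open>The prefactor is split off so that what remains is
      \<open>s powr (- 1 - \<gamma>) / K\<close>, a lower bound for the weight, times the unweighted
      measure of the cylinder.\<close>
    have "ennreal (s powr (- \<gamma>)) * emeasure \<mu> U =
        ennreal ((K / (\<beta> - \<alpha>)) * ((s powr (- 1 - \<gamma>) / K) * ((\<beta> - \<alpha>) * s))) * emeasure \<mu> U"
      using pw[OF U(2)] K(1) cancel[of "\<beta> - \<alpha>" "s powr (- 1 - \<gamma>)" s] assms by simp
    also have "\<dots> = ennreal (K / (\<beta> - \<alpha>)) * (ennreal (s powr (- 1 - \<gamma>) / K) * (emeasure \<mu> U * ennreal ((\<beta> - \<alpha>) * s)))"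
      using K(1) assms U by (intro ennreal_mult3) auto
    also have "ennreal (s powr (- 1 - \<gamma>) / K) * (emeasure \<mu> U * ennreal ((\<beta> - \<alpha>) * s)) =
        (\<integral>\<^sup>+z. ennreal (s powr (- 1 - \<gamma>) / K) * indicator ?E z \<partial>(\<mu> \<Otimes>\<^sub>M ?\<rho>))"
      using meas[OF U] prod[OF U] by (simp add: nn_integral_cmult_indicator)
    also have "\<dots> \<le> emeasure (nu \<mu> \<gamma>) ?E"
      unfolding int[OF U] using K(1,3) U
      by (intro nn_integral_mono) (auto simp: indicator_def divide_le_eq ac_simps intro!: ennreal_leI)
    also have "ennreal (K / (\<beta> - \<alpha>)) * emeasure (nu \<mu> \<gamma>) ?E \<le> ennreal K' * emeasure (nu \<mu> \<gamma>) ?E"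
      using le2 by (intro mult_right_mono ennreal_leI) auto
    finally show "ennreal (s powr (- \<gamma>)) * emeasure \<mu> U \<le> ennreal K' * emeasure (nu \<mu> \<gamma>) ?E"
      by (simp add: mult_left_mono)
  qed
qed

end

section \<open>Comparison of distribution functions\<close>

text \<open>The supremum of a finite sum is at most the sum of the suprema, hence at most
  \<open>card J\<close> times the largest of them.\<close>

lemma weak_norm_le_Max:
  assumes J: "finite J" "J \<noteq> {}" and pos: "0 < p" "0 < C" "0 < K"
    and le: "\<And>l. 0 < l \<Longrightarrow> \<phi> l \<le> ennreal C * (\<Sum>j\<in>J. \<psi> j (l / K))"
  shows "enn_powr (SUP l\<in>{0<..}. ennreal (l powr p) * \<phi> l) (1 / p) \<le>
    ennreal ((C * K powr p * real (card J)) powr (1 / p)) *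
      (MAX j\<in>J. enn_powr (SUP l\<in>{0<..}. ennreal (l powr p) * \<psi> j l) (1 / p))"
proof -
  define X where "X j = (SUP l\<in>{0<..}. ennreal (l powr p) * \<psi> j l)" for j
  have "Max (X ` J) \<in> X ` J" using J by (intro Max_in) auto
  \<comment> \<open>Fixing an index where the maximum is attained avoids commuting
    \<open>Max\<close> with the root: the root of \<open>X j0\<close> is one of the values in the
    final maximum.\<close>
  then obtain j0 where j0: "j0 \<in> J" "Max (X ` J) = X j0" by auto
  then have max: "X j \<le> X j0" if "j \<in> J" for j
    using that J by (metis Max_ge finite_imageI imageI)
  have "(SUP l\<in>{0<..}. ennreal (l powr p) * (\<Sum>j\<in>J. \<psi> j l)) \<le> (\<Sum>j\<in>J. X j)"
    unfolding sum_distrib_left X_def by (intro SUP_least sum_mono SUP_upper)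
  also have "\<dots> \<le> of_nat (card J) * X j0"
    using max by (rule sum_bounded_above)
  finally have "(SUP l\<in>{0<..}. ennreal (l powr p) * \<phi> l) \<le>
      ennreal (C * K powr p) * (ennreal (real (card J)) * X j0)"
    using weak_sup_rescale[of K \<phi> C "\<lambda>l. \<Sum>j\<in>J. \<psi> j l" p, OF pos(3) le]
    by (simp add: ennreal_of_nat_eq_real_of_nat) (rule order_trans, assumption, rule mult_left_mono, auto)
  then have "(SUP l\<in>{0<..}. ennreal (l powr p) * \<phi> l) \<le> ennreal (C * K powr p * real (card J)) * X j0"
    using pos by (simp add: ennreal_mult mult.assoc)
  moreover have "0 < C * K powr p * real (card J)"
    using pos J by (simp add: card_gt_0_iff)
  ultimately have "enn_powr (SUP l\<in>{0<..}. ennreal (l powr p) * \<phi> l) (1 / p) \<le>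
      ennreal ((C * K powr p * real (card J)) powr (1 / p)) * enn_powr (X j0) (1 / p)"
    using pos by (intro enn_powr_le_cmult) auto
  also have "enn_powr (X j0) (1 / p) \<le> (MAX j\<in>J. enn_powr (X j) (1 / p))"
    using J j0 by (intro Max_ge) auto
  finally show ?thesis unfolding X_def by (simp add: mult_left_mono)
qed

context doubling_space
begin

text \<open>The cylinder of each cube that counts at level \<open>l\<close> lies in the set where
  \<open>F\<close> exceeds \<open>l / K\<close> in absolute value, and disjointness lets the
  measures add up. Measurability of \<open>F\<close> makes that level set measurable, as
  monotonicity of \<open>emeasure\<close> demands.\<close>

lemma seq_distr_le_fun_distr:
  obtains C where "0 < C"
    "\<And>K s F l. F \<in> borel_measurable (nu \<mu> \<gamma>) \<Longrightarrow> 0 < K \<Longrightarrow>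
      (\<And>Q x t. Q \<in> std_dyadic \<Longrightarrow> x \<in> Q \<Longrightarrow> of_nat CARD('n) * sidelength Q < t \<Longrightarrow>
        t < 2 * of_nat CARD('n) * sidelength Q \<Longrightarrow> \<bar>s Q\<bar> \<le> K * \<bar>F (x, t)\<bar>) \<Longrightarrow>
      seq_distr \<gamma> \<mu> std_dyadic s l \<le> ennreal C * fun_distr \<gamma> \<mu> F (l / K)"
proof -
  define N :: real where "N = of_nat CARD('n)"
  have N: "0 < N" "N < 2 * N" by (simp_all add: N_def)
  obtain C where C: "0 < C" "\<And>U s. U \<in> sets borel \<Longrightarrow> 0 < s \<Longrightarrow>
      ennreal (s powr (- \<gamma>)) * emeasure \<mu> U \<le> ennreal C * emeasure (nu \<mu> \<gamma>) (U \<times> {N * s<..<2 * N * s})"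
    by (rule nu_cylinder[OF N, of \<gamma>]) blast
  show ?thesis
  proof (rule that[OF C(1)])
    fix K l :: real and s and F :: "(real ^ 'n) \<times> real \<Rightarrow> real"
    assume F [measurable]: "F \<in> borel_measurable (nu \<mu> \<gamma>)" and K: "0 < K"
      and le: "\<And>Q x t. Q \<in> std_dyadic \<Longrightarrow> x \<in> Q \<Longrightarrow> of_nat CARD('n) * sidelength Q < t \<Longrightarrow>
        t < 2 * of_nat CARD('n) * sidelength Q \<Longrightarrow> \<bar>s Q\<bar> \<le> K * \<bar>F (x, t)\<bar>"
    let ?S = "{Q \<in> std_dyadic. \<bar>s Q\<bar> > l}"
    define W where "W Q = Q \<times> {N * sidelength Q<..<2 * N * sidelength Q}" for Q :: "(real ^ 'n) set"
    have W: "W Q \<in> sets (nu \<mu> \<gamma>)" if "Q \<in> std_dyadic" for Q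
      unfolding W_def using that N sidelength_pos[OF std_dyadic_is_cube[OF that]]
      by (intro cylinder_sets cube_borel std_dyadic_is_cube) auto
    have disj: "W P \<inter> W Q = {}" if PQ: "P \<in> std_dyadic" "Q \<in> std_dyadic" "P \<noteq> Q" for P Q
    proof (rule ccontr)
      assume "W P \<inter> W Q \<noteq> {}"
      then obtain x t where xt: "x \<in> P" "x \<in> Q"
        "N * sidelength P < t" "t < 2 * N * sidelength P" "N * sidelength Q < t" "t < 2 * N * sidelength Q"
        by (auto simp: W_def)
      \<comment> \<open>Overlapping heights put each side length below twice the other, so the two
        dyadic lengths coincide; cubes of one generation with a common point are then equal.\<close>
      then have "N * sidelength P < N * (2 * sidelength Q)" "N * sidelength Q < N * (2 * sidelength P)"
        by (simp_all add: ac_simps)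
      then have "sidelength P < 2 * sidelength Q" "sidelength Q < 2 * sidelength P"
        using N by simp_all
      then have "sidelength P = sidelength Q"
        using std_dyadic_sidelength_less PQ by (metis linorder_neqE_linordered_idom not_le)
      then show False using std_dyadic_eq PQ xt by blast
    qed
    show "seq_distr \<gamma> \<mu> std_dyadic s l \<le> ennreal C * fun_distr \<gamma> \<mu> F (l / K)"
      unfolding seq_distr_def
    proof (rule infsum_le_ennreal)
      \<comment> \<open>Bounding the finite partial sums bounds the whole sum, so finite additivity
        on the disjoint cylinders is enough.\<close>
      fix A assume A: "finite A" "A \<subseteq> ?S"
      have "(\<Sum>Q\<in>A. ennreal (sidelength Q powr (- \<gamma>)) * emeasure \<mu> Q) \<le> (\<Sum>Q\<in>A. ennreal C * emeasure (nu \<mu> \<gamma>) (W Q))"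
        unfolding W_def using A(2)
        by (intro sum_mono C(2) cube_borel sidelength_pos std_dyadic_is_cube) auto
      also have "\<dots> = ennreal C * emeasure (nu \<mu> \<gamma>) (\<Union>Q\<in>A. W Q)"
        using A W disj unfolding sum_distrib_left[symmetric]
        by (subst sum_emeasure) (auto simp: disjoint_family_on_def subset_iff)
      also have "\<dots> \<le> ennreal C * fun_distr \<gamma> \<mu> F (l / K)"
        unfolding fun_distr_def
      proof (intro mult_left_mono emeasure_mono subsetI)
        fix z assume "z \<in> (\<Union>Q\<in>A. W Q)"
        then obtain Q x t where z: "Q \<in> A" "z = (x, t)" "x \<in> Q" "N * sidelength Q < t" "t < 2 * N * sidelength Q"
          by (auto simp: W_def)
        then have Q: "Q \<in> std_dyadic" "l < \<bar>s Q\<bar>" using A by auto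
        then have "l < K * \<bar>F z\<bar>" using le[OF Q(1) z(3), of t] z by (simp add: N_def)
        moreover have "z \<in> W Q" using z by (simp add: W_def)
        ultimately show "z \<in> {z \<in> space (nu \<mu> \<gamma>). l / K < \<bar>F z\<bar>}"
          using K W[OF Q(1), THEN sets.sets_into_space] by (auto simp: divide_less_eq ac_simps)
      qed auto
      finally show "(\<Sum>Q\<in>A. ennreal (sidelength Q powr (- \<gamma>)) * emeasure \<mu> Q) \<le> ennreal C * fun_distr \<gamma> \<mu> F (l / K)" .
    qed
  qed
qed

text \<open>The cylinders are open, so Lindelof's theorem provides the countability needed for
  subadditivity even though \<open>S\<close> is an arbitrary collection of cubes.\<close>

lemma nu_Union_cylinders:
  fixes \<alpha> \<beta> :: real
  assumes "0 < \<alpha>" "\<alpha> < \<beta>"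
  obtains C where "0 < C"
    "\<And>S. (\<And>Q. Q \<in> S \<Longrightarrow> is_cube Q) \<Longrightarrow>
      (\<Union>Q\<in>S. nbhd \<beta> Q \<times> {\<alpha> * sidelength Q<..<\<beta> * sidelength Q}) \<in> sets (nu \<mu> \<gamma>)"
    "\<And>S. (\<And>Q. Q \<in> S \<Longrightarrow> is_cube Q) \<Longrightarrow>
      emeasure (nu \<mu> \<gamma>) (\<Union>Q\<in>S. nbhd \<beta> Q \<times> {\<alpha> * sidelength Q<..<\<beta> * sidelength Q}) \<le>
        ennreal C * (\<Sum>\<^sub>\<infinity>Q\<in>S. ennreal (sidelength Q powr (- \<gamma>)) * emeasure \<mu> Q)"
proof -
  obtain C1 where C1: "0 < C1" "\<And>U s. U \<in> sets borel \<Longrightarrow> 0 < s \<Longrightarrow>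
      emeasure (nu \<mu> \<gamma>) (U \<times> {\<alpha> * s<..<\<beta> * s}) \<le> ennreal C1 * (ennreal (s powr (- \<gamma>)) * emeasure \<mu> U)"
    by (rule nu_cylinder[OF assms, of \<gamma>]) blast
  obtain C2 where C2: "0 < C2" "\<And>Q. is_cube Q \<Longrightarrow> emeasure \<mu> (nbhd \<beta> Q) \<le> ennreal C2 * emeasure \<mu> Q"
    by (rule nbhd_comparable[of \<beta>]) blast
  define E where "E Q = nbhd \<beta> Q \<times> {\<alpha> * sidelength Q<..<\<beta> * sidelength Q}" for Q :: "(real ^ 'n) set"
  have E: "E Q \<in> sets (nu \<mu> \<gamma>)" if "is_cube Q" for Q
    unfolding E_def using sidelength_pos[OF that] assms by (intro cylinder_sets nbhd_borel) auto
  have le: "emeasure (nu \<mu> \<gamma>) (E Q) \<le> ennreal (C1 * C2) * (ennreal (sidelength Q powr (- \<gamma>)) * emeasure \<mu> Q)"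
    if "is_cube Q" for Q
  proof -
    have "emeasure (nu \<mu> \<gamma>) (E Q) \<le> ennreal C1 * (ennreal (sidelength Q powr (- \<gamma>)) * emeasure \<mu> (nbhd \<beta> Q))"
      unfolding E_def using sidelength_pos[OF that] by (intro C1 nbhd_borel)
    also have "\<dots> \<le> ennreal C1 * (ennreal (sidelength Q powr (- \<gamma>)) * (ennreal C2 * emeasure \<mu> Q))"
      using C2(2)[OF that] by (intro mult_left_mono) auto
    finally show ?thesis using C1(1) C2(1) by (simp add: ennreal_mult ac_simps)
  qed
  have ex: "\<exists>S'\<subseteq>S. countable S' \<and> (\<Union>Q\<in>S'. E Q) = (\<Union>Q\<in>S. E Q)" for S
  proof -
    have "open X" if "X \<in> E ` S" for X
      using that by (auto simp: E_def open_nbhd open_Times)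
    then obtain G where "G \<subseteq> E ` S" "countable G" "\<Union>G = \<Union>(E ` S)"
      by (rule Lindelof)
    \<comment> \<open>Lindelof selects countably many cylinders as sets; choosing preimages under
      \<open>E\<close> turns them into countably many cubes, over which the sum is indexed.\<close>
    moreover from this obtain S' where "countable S'" "S' \<subseteq> S" "G = E ` S'"
      using countable_subset_image[of G E S] by metis
    ultimately show ?thesis by metis
  qed
  show ?thesis
  proof (rule that, unfold E_def[symmetric])
    show "0 < C1 * C2" using C1 C2 by simp
  next
    fix S :: "(real ^ 'n) set set" assume S: "\<And>Q. Q \<in> S \<Longrightarrow> is_cube Q"
    obtain S' where S': "S' \<subseteq> S" "countable S'" "(\<Union>Q\<in>S'. E Q) = (\<Union>Q\<in>S. E Q)" using ex by metis
    have E': "E Q \<in> sets (nu \<mu> \<gamma>)" if "Q \<in> S'" for Q using E S S' that by auto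
    show "(\<Union>Q\<in>S. E Q) \<in> sets (nu \<mu> \<gamma>)"
      unfolding S'(3)[symmetric] using S'(2) E' by (intro sets.countable_UN') auto
    have "emeasure (nu \<mu> \<gamma>) (\<Union>Q\<in>S. E Q) \<le> (\<Sum>\<^sub>\<infinity>Q\<in>S'. emeasure (nu \<mu> \<gamma>) (E Q))"
      unfolding S'(3)[symmetric] using S'(2) E' by (rule emeasure_UN_le_infsum)
    also have "\<dots> \<le> ennreal (C1 * C2) * (\<Sum>\<^sub>\<infinity>Q\<in>S. ennreal (sidelength Q powr (- \<gamma>)) * emeasure \<mu> Q)"
    proof (rule infsum_le_ennreal)
      fix A assume A: "finite A" "A \<subseteq> S'"
      have "(\<Sum>Q\<in>A. emeasure (nu \<mu> \<gamma>) (E Q)) \<le>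
          (\<Sum>Q\<in>A. ennreal (C1 * C2) * (ennreal (sidelength Q powr (- \<gamma>)) * emeasure \<mu> Q))"
        using A S S' by (intro sum_mono le) auto
      also have "\<dots> \<le> ennreal (C1 * C2) * (\<Sum>\<^sub>\<infinity>Q\<in>S. ennreal (sidelength Q powr (- \<gamma>)) * emeasure \<mu> Q)"
        unfolding sum_distrib_left[symmetric] using A S' by (intro mult_left_mono sum_le_infsum_ennreal) auto
      finally show "(\<Sum>Q\<in>A. emeasure (nu \<mu> \<gamma>) (E Q)) \<le> \<dots>" .
    qed
    finally show "emeasure (nu \<mu> \<gamma>) (\<Union>Q\<in>S. E Q) \<le> \<dots>" .
  qed
qed

text \<open>The cylinders over the cubes that count at level \<open>l / K\<close> cover the level
  set of \<open>F\<close>, and subadditivity is applied first over \<open>J\<close> and then within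
  each family. The index set allows both a single system and the whole covering family.\<close>

lemma fun_distr_le_seq_distr:
  fixes \<alpha> \<beta> :: real
  assumes "0 < \<alpha>" "\<alpha> < \<beta>"
  obtains C where "0 < C"
    "\<And>(J :: nat set) D K s F l. finite J \<Longrightarrow> (\<And>j Q. j \<in> J \<Longrightarrow> Q \<in> D j \<Longrightarrow> is_cube Q) \<Longrightarrow> 0 < K \<Longrightarrow>
      (\<And>x t. 0 < t \<Longrightarrow> \<exists>j\<in>J. \<exists>Q\<in>D j. x \<in> nbhd \<beta> Q \<and> \<alpha> * sidelength Q < t \<and> t < \<beta> * sidelength Q \<and>
        \<bar>F (x, t)\<bar> \<le> K * \<bar>s Q\<bar>) \<Longrightarrow>
      fun_distr \<gamma> \<mu> F l \<le> ennreal C * (\<Sum>j\<in>J. seq_distr \<gamma> \<mu> (D j) s (l / K))"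
proof -
  define E where "E Q = nbhd \<beta> Q \<times> {\<alpha> * sidelength Q<..<\<beta> * sidelength Q}" for Q :: "(real ^ 'n) set"
  obtain C where C: "0 < C"
    "\<And>S. (\<And>Q. Q \<in> S \<Longrightarrow> is_cube Q) \<Longrightarrow> (\<Union>Q\<in>S. E Q) \<in> sets (nu \<mu> \<gamma>)"
    "\<And>S. (\<And>Q. Q \<in> S \<Longrightarrow> is_cube Q) \<Longrightarrow> emeasure (nu \<mu> \<gamma>) (\<Union>Q\<in>S. E Q) \<le>
        ennreal C * (\<Sum>\<^sub>\<infinity>Q\<in>S. ennreal (sidelength Q powr (- \<gamma>)) * emeasure \<mu> Q)"
    unfolding E_def by (rule nu_Union_cylinders[OF assms, of \<gamma>]) blast
  show ?thesis
  proof (rule that[OF C(1)])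
    fix J :: "nat set" and D K s l and F :: "(real ^ 'n) \<times> real \<Rightarrow> real"
    assume J: "finite J" and D: "\<And>j Q. j \<in> J \<Longrightarrow> Q \<in> D j \<Longrightarrow> is_cube Q" and K: "0 < K"
      and ex: "\<And>x t. 0 < t \<Longrightarrow> \<exists>j\<in>J. \<exists>Q\<in>D j. x \<in> nbhd \<beta> Q \<and> \<alpha> * sidelength Q < t \<and>
        t < \<beta> * sidelength Q \<and> \<bar>F (x, t)\<bar> \<le> K * \<bar>s Q\<bar>"
    define S where "S j = {Q \<in> D j. l / K < \<bar>s Q\<bar>}" for j
    have cube: "is_cube Q" if "j \<in> J" "Q \<in> S j" for j Q using D that by (auto simp: S_def)
    have "{z \<in> space (nu \<mu> \<gamma>). l < \<bar>F z\<bar>} \<subseteq> (\<Union>j\<in>J. \<Union>Q\<in>S j. E Q)"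
    proof
      fix z assume "z \<in> {z \<in> space (nu \<mu> \<gamma>). l < \<bar>F z\<bar>}"
      then obtain x t where z: "z = (x, t)" "0 < t" "l < \<bar>F (x, t)\<bar>" by (auto simp: space_nu)
      then obtain j Q where jQ: "j \<in> J" "Q \<in> D j" "x \<in> nbhd \<beta> Q" "\<alpha> * sidelength Q < t"
        "t < \<beta> * sidelength Q" "\<bar>F (x, t)\<bar> \<le> K * \<bar>s Q\<bar>"
        using ex by blast
      then have "l < K * \<bar>s Q\<bar>" using z by linarith
      then have "Q \<in> S j" using K jQ by (simp add: S_def divide_less_eq ac_simps)
      moreover have "z \<in> E Q" using z jQ by (simp add: E_def)
      ultimately show "z \<in> (\<Union>j\<in>J. \<Union>Q\<in>S j. E Q)" using jQ(1) by blast
    qed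
    \<comment> \<open>Monotonicity of \<open>emeasure\<close> asks for measurability of the covering
      set, which \<open>C(2)\<close> provides.\<close>
    then have "fun_distr \<gamma> \<mu> F l \<le> emeasure (nu \<mu> \<gamma>) (\<Union>j\<in>J. \<Union>Q\<in>S j. E Q)"
      unfolding fun_distr_def using cube by (intro emeasure_mono sets.finite_UN[OF J C(2)]) auto
    also have "\<dots> \<le> (\<Sum>j\<in>J. emeasure (nu \<mu> \<gamma>) (\<Union>Q\<in>S j. E Q))"
      using J C(2) cube by (intro emeasure_subadditive_finite) auto
    also have "\<dots> \<le> (\<Sum>j\<in>J. ennreal C * seq_distr \<gamma> \<mu> (D j) s (l / K))"
      unfolding seq_distr_def S_def[symmetric] using cube by (intro sum_mono C(3)) auto
    finally show "fun_distr \<gamma> \<mu> F l \<le> ennreal C * (\<Sum>j\<in>J. seq_distr \<gamma> \<mu> (D j) s (l / K))"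
      by (simp add: sum_distrib_left)
  qed
qed

section \<open>Measurability on the upper half-space and local integrability\<close>

lemma fst_nu_measurable [measurable]: "fst \<in> \<mu> \<Otimes>\<^sub>M M \<rightarrow>\<^sub>M borel"
  using measurable_fst[of \<mu> M] measurable_cong_sets[OF refl sets_eq, of "\<mu> \<Otimes>\<^sub>M M"] by blast

text \<open>The indicator of a ball is jointly measurable in centre, radius and point, so the
  integral over a moving ball is a parametrised integral against a fixed sigma-finite measure. The
  integrand \<open>g\<close> may depend on the ball because an oscillation contains the mean over
  the same ball.\<close>

lemma avg_ball_measurable:
  fixes g :: "((real ^ 'n) \<times> real) \<times> (real ^ 'n) \<Rightarrow> 'b::{banach, second_countable_topology}"
  defines "N \<equiv> \<mu> \<Otimes>\<^sub>M restrict_space lborel {0::real<..}"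
  assumes g [measurable]: "g \<in> borel_measurable (N \<Otimes>\<^sub>M \<mu>)"
  shows "(\<lambda>z. avg \<mu> (\<lambda>y. g (z, y)) (ball (fst z) (snd z))) \<in> borel_measurable N"
proof -
  interpret sigma_finite_measure \<mu> by (rule sigma_finite)
  have [measurable]: "fst \<in> N \<rightarrow>\<^sub>M borel" "snd \<in> N \<rightarrow>\<^sub>M borel" unfolding N_def by measurable
  have y [measurable]: "snd \<in> N \<Otimes>\<^sub>M \<mu> \<rightarrow>\<^sub>M borel"
    using measurable_snd[of N \<mu>] measurable_cong_sets[OF refl sets_eq, of "N \<Otimes>\<^sub>M \<mu>"] by blast
  have ind [measurable]: "(\<lambda>w. indicator (ball (fst (fst w)) (snd (fst w))) (snd w) :: real) \<in> borel_measurable (N \<Otimes>\<^sub>M \<mu>)"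
  proof -
    have "(\<lambda>w. if dist (fst (fst w)) (snd w) < snd (fst w) then 1 else 0 :: real) \<in> borel_measurable (N \<Otimes>\<^sub>M \<mu>)"
      by measurable
    then show ?thesis by (simp add: indicator_def)
  qed
  have "(\<lambda>z. LINT y|\<mu>. indicator (ball (fst z) (snd z)) y *\<^sub>R g (z, y)) \<in> borel_measurable N"
    using borel_measurable_scaleR[OF ind g]
    by (intro borel_measurable_lebesgue_integral) (simp add: case_prod_beta)
  moreover have "(\<lambda>z. LINT y|\<mu>. indicator (ball (fst z) (snd z)) y :: real) \<in> borel_measurable N"
    using ind by (intro borel_measurable_lebesgue_integral) (simp add: case_prod_beta)
  then have "(\<lambda>z. measure \<mu> (ball (fst z) (snd z))) \<in> borel_measurable N"
    by (simp add: space_eq)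
  ultimately show ?thesis
    unfolding avg_def set_lebesgue_integral_def by measurable
qed

lemma powr_mult_nu_measurable:
  assumes "h \<in> borel_measurable (\<mu> \<Otimes>\<^sub>M restrict_space lborel {0::real<..})"
  shows "(\<lambda>(x, t). t powr q * h (x, t)) \<in> borel_measurable (nu \<mu> \<gamma>)"
proof -
  have "(\<lambda>z. snd z powr q * h z) \<in> borel_measurable (\<mu> \<Otimes>\<^sub>M restrict_space lborel {0::real<..})"
    using assms by measurable
  then show ?thesis
    unfolding nu_def case_prod_beta by simp
qed

lemma locally_integrable_subset:
  fixes f :: "real ^ 'n \<Rightarrow> 'b::{banach, second_countable_topology}"
  assumes "locally_integrable \<mu> f" "A \<in> sets borel" "A \<subseteq> ball x r"
  shows "set_integrable \<mu> A f"
proof (rule set_integrable_subset)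
  show "set_integrable \<mu> (cball x r) f" using assms(1) by (simp add: locally_integrable_def)
  show "A \<subseteq> cball x r" using assms(3) ball_subset_cball by blast
qed (use assms in auto)

text \<open>The truncations of \<open>f\<close> to balls of integer radius are integrable, and at
  each point they are eventually equal to \<open>f\<close>.\<close>

lemma locally_integrable_measurable:
  fixes f :: "real ^ 'n \<Rightarrow> 'b::{banach, second_countable_topology}"
  assumes "locally_integrable \<mu> f"
  shows "f \<in> borel_measurable \<mu>"
proof (rule borel_measurable_LIMSEQ_metric)
  show "(\<lambda>x. indicator (ball 0 (real i)) x *\<^sub>R f x) \<in> borel_measurable \<mu>" for i
    using locally_integrable_subset[OF assms, of "ball 0 (real i)" 0 "real i"]
    unfolding set_integrable_def by auto
next
  fix x :: "real ^ 'n"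
  obtain m :: nat where m: "norm x < real m" using reals_Archimedean2 by blast
  have "eventually (\<lambda>i. indicator (ball 0 (real i)) x *\<^sub>R f x = f x) sequentially"
    using eventually_ge_at_top[of m] by eventually_elim (use m in auto)
  then show "(\<lambda>i. indicator (ball 0 (real i)) x *\<^sub>R f x) \<longlonglongrightarrow> f x"
    by (rule tendsto_eventually)
qed

lemma cube_subset_ball:
  fixes Q :: "(real ^ 'n) set"
  assumes "is_cube Q"
  obtains c r where "Q \<subseteq> ball c r"
proof -
  obtain c where "c \<in> Q" using assms by (rule cube_contains_ball)
  then have "Q \<subseteq> ball c (of_nat CARD('n) * sidelength Q)" using dist_cube[OF assms] by auto
  then show ?thesis by (rule that)
qed

section \<open>From distribution functions to weak quantities\<close>

text \<open>The constant is fixed before \<open>s\<close> and \<open>F\<close> are chosen, which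
  later yields its independence of the function.\<close>

lemma seq_weak_le_fun_weak:
  assumes "1 \<le> p" "0 < K"
  obtains c where "0 < c"
    "\<And>s F. F \<in> borel_measurable (nu \<mu> \<gamma>) \<Longrightarrow>
      (\<And>Q x t. Q \<in> std_dyadic \<Longrightarrow> x \<in> Q \<Longrightarrow> of_nat CARD('n) * sidelength Q < t \<Longrightarrow>
        t < 2 * of_nat CARD('n) * sidelength Q \<Longrightarrow> \<bar>s Q\<bar> \<le> K * \<bar>F (x, t)\<bar>) \<Longrightarrow>
      lesssim c (seq_weak_norm p \<gamma> \<mu> std_dyadic s) (fun_weak_norm p \<gamma> \<mu> F) \<and>
      lesssim c (seq_weak_lim p \<gamma> \<mu> std_dyadic s) (fun_weak_lim p \<gamma> \<mu> F)"
proof -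
  obtain C where C: "0 < C"
    "\<And>K s F l. F \<in> borel_measurable (nu \<mu> \<gamma>) \<Longrightarrow> 0 < K \<Longrightarrow>
      (\<And>Q x t. Q \<in> std_dyadic \<Longrightarrow> x \<in> Q \<Longrightarrow> of_nat CARD('n) * sidelength Q < t \<Longrightarrow>
        t < 2 * of_nat CARD('n) * sidelength Q \<Longrightarrow> \<bar>s Q\<bar> \<le> K * \<bar>F (x, t)\<bar>) \<Longrightarrow>
      seq_distr \<gamma> \<mu> std_dyadic s l \<le> ennreal C * fun_distr \<gamma> \<mu> F (l / K)"
    by (rule seq_distr_le_fun_distr[of \<gamma>]) blast
  show ?thesis
  proof (rule that)
    show "0 < (C * K powr p) powr (1 / p)" using C assms by simp
    fix s and F :: "(real ^ 'n) \<times> real \<Rightarrow> real"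
    assume *: "F \<in> borel_measurable (nu \<mu> \<gamma>)"
        "\<And>Q x t. Q \<in> std_dyadic \<Longrightarrow> x \<in> Q \<Longrightarrow> of_nat CARD('n) * sidelength Q < t \<Longrightarrow>
        t < 2 * of_nat CARD('n) * sidelength Q \<Longrightarrow> \<bar>s Q\<bar> \<le> K * \<bar>F (x, t)\<bar>"
    have "seq_distr \<gamma> \<mu> std_dyadic s l \<le> ennreal C * fun_distr \<gamma> \<mu> F (l / K)" for l
      by (rule C(2)) (use assms * in auto)
    then show "lesssim ((C * K powr p) powr (1 / p)) (seq_weak_norm p \<gamma> \<mu> std_dyadic s) (fun_weak_norm p \<gamma> \<mu> F) \<and>
      lesssim ((C * K powr p) powr (1 / p)) (seq_weak_lim p \<gamma> \<mu> std_dyadic s) (fun_weak_lim p \<gamma> \<mu> F)"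
      unfolding lesssim_def seq_weak_norm_def fun_weak_norm_def seq_weak_lim_def fun_weak_lim_def
      using assms C(1) by (intro conjI weak_bounds_rescale) auto
  qed
qed

text \<open>Only norms are compared for several systems: a lower limit of a sum is in general not
  controlled by the sum of the lower limits.\<close>

lemma fun_weak_le_Max_seq_weak:
  fixes \<alpha> \<beta> :: real and J :: "nat set"
  assumes "0 < \<alpha>" "\<alpha> < \<beta>" "1 \<le> p" "0 < K" "finite J" "J \<noteq> {}"
  obtains c where "0 < c"
    "\<And>D s F. (\<And>j Q. j \<in> J \<Longrightarrow> Q \<in> D j \<Longrightarrow> is_cube Q) \<Longrightarrow>
      (\<And>x t. 0 < t \<Longrightarrow> \<exists>j\<in>J. \<exists>Q\<in>D j. x \<in> nbhd \<beta> Q \<and> \<alpha> * sidelength Q < t \<and> t < \<beta> * sidelength Q \<and>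
        \<bar>F (x, t)\<bar> \<le> K * \<bar>s Q\<bar>) \<Longrightarrow>
      lesssim c (fun_weak_norm p \<gamma> \<mu> F) (MAX j\<in>J. seq_weak_norm p \<gamma> \<mu> (D j) s)"
proof -
  obtain C where C: "0 < C"
    "\<And>(J :: nat set) D K s F l. finite J \<Longrightarrow> (\<And>j Q. j \<in> J \<Longrightarrow> Q \<in> D j \<Longrightarrow> is_cube Q) \<Longrightarrow> 0 < K \<Longrightarrow>
      (\<And>x t. 0 < t \<Longrightarrow> \<exists>j\<in>J. \<exists>Q\<in>D j. x \<in> nbhd \<beta> Q \<and> \<alpha> * sidelength Q < t \<and> t < \<beta> * sidelength Q \<and>
        \<bar>F (x, t)\<bar> \<le> K * \<bar>s Q\<bar>) \<Longrightarrow>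
      fun_distr \<gamma> \<mu> F l \<le> ennreal C * (\<Sum>j\<in>J. seq_distr \<gamma> \<mu> (D j) s (l / K))"
    by (rule fun_distr_le_seq_distr[OF assms(1,2), of \<gamma>]) blast
  show ?thesis
  proof (rule that)
    show "0 < (C * K powr p * real (card J)) powr (1 / p)" using C(1) assms by (simp add: card_gt_0_iff)
    fix D s and F :: "(real ^ 'n) \<times> real \<Rightarrow> real"
    assume *: "\<And>j Q. j \<in> J \<Longrightarrow> Q \<in> D j \<Longrightarrow> is_cube Q"
      "\<And>x t. 0 < t \<Longrightarrow> \<exists>j\<in>J. \<exists>Q\<in>D j. x \<in> nbhd \<beta> Q \<and> \<alpha> * sidelength Q < t \<and> t < \<beta> * sidelength Q \<and>
        \<bar>F (x, t)\<bar> \<le> K * \<bar>s Q\<bar>"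
    have "fun_distr \<gamma> \<mu> F l \<le> ennreal C * (\<Sum>j\<in>J. seq_distr \<gamma> \<mu> (D j) s (l / K))" for l
      by (rule C(2)) (use assms * in auto)
    then show "lesssim ((C * K powr p * real (card J)) powr (1 / p)) (fun_weak_norm p \<gamma> \<mu> F)
        (MAX j\<in>J. seq_weak_norm p \<gamma> \<mu> (D j) s)"
      unfolding lesssim_def seq_weak_norm_def fun_weak_norm_def
      using assms C(1) by (intro weak_norm_le_Max) auto
  qed
qed

lemma fun_weak_le_seq_weak:
  fixes \<alpha> \<beta> :: real
  assumes "0 < \<alpha>" "\<alpha> < \<beta>" "1 \<le> p" "0 < K"
  obtains c where "0 < c"
    "\<And>D s F. (\<And>Q. Q \<in> D \<Longrightarrow> is_cube Q) \<Longrightarrow>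
      (\<And>x t. 0 < t \<Longrightarrow> \<exists>Q\<in>D. x \<in> nbhd \<beta> Q \<and> \<alpha> * sidelength Q < t \<and> t < \<beta> * sidelength Q \<and>
        \<bar>F (x, t)\<bar> \<le> K * \<bar>s Q\<bar>) \<Longrightarrow>
      lesssim c (fun_weak_norm p \<gamma> \<mu> F) (seq_weak_norm p \<gamma> \<mu> D s) \<and>
      lesssim c (fun_weak_lim p \<gamma> \<mu> F) (seq_weak_lim p \<gamma> \<mu> D s)"
proof -
  obtain C where C: "0 < C"
    "\<And>(J :: nat set) D K s F l. finite J \<Longrightarrow> (\<And>j Q. j \<in> J \<Longrightarrow> Q \<in> D j \<Longrightarrow> is_cube Q) \<Longrightarrow> 0 < K \<Longrightarrow>
      (\<And>x t. 0 < t \<Longrightarrow> \<exists>j\<in>J. \<exists>Q\<in>D j. x \<in> nbhd \<beta> Q \<and> \<alpha> * sidelength Q < t \<and> t < \<beta> * sidelength Q \<and>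
        \<bar>F (x, t)\<bar> \<le> K * \<bar>s Q\<bar>) \<Longrightarrow>
      fun_distr \<gamma> \<mu> F l \<le> ennreal C * (\<Sum>j\<in>J. seq_distr \<gamma> \<mu> (D j) s (l / K))"
    by (rule fun_distr_le_seq_distr[OF assms(1,2), of \<gamma>]) blast
  show ?thesis
  proof (rule that)
    show "0 < (C * K powr p) powr (1 / p)" using C(1) assms by simp
    fix D s and F :: "(real ^ 'n) \<times> real \<Rightarrow> real"
    assume *: "\<And>Q. Q \<in> D \<Longrightarrow> is_cube Q"
      "\<And>x t. 0 < t \<Longrightarrow> \<exists>Q\<in>D. x \<in> nbhd \<beta> Q \<and> \<alpha> * sidelength Q < t \<and> t < \<beta> * sidelength Q \<and>
        \<bar>F (x, t)\<bar> \<le> K * \<bar>s Q\<bar>"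
    \<comment> \<open>A single system is a family indexed by one element. The sum collapses, so the
      endpoint limits can be compared as well.\<close>
    have "fun_distr \<gamma> \<mu> F l \<le> ennreal C * (\<Sum>j\<in>{0::nat}. seq_distr \<gamma> \<mu> D s (l / K))" for l
      by (rule C(2)) (use assms * in auto)
    then have "fun_distr \<gamma> \<mu> F l \<le> ennreal C * seq_distr \<gamma> \<mu> D s (l / K)" for l by simp
    then show "lesssim ((C * K powr p) powr (1 / p)) (fun_weak_norm p \<gamma> \<mu> F) (seq_weak_norm p \<gamma> \<mu> D s) \<and>
        lesssim ((C * K powr p) powr (1 / p)) (fun_weak_lim p \<gamma> \<mu> F) (seq_weak_lim p \<gamma> \<mu> D s)"
      unfolding lesssim_def seq_weak_norm_def fun_weak_norm_def seq_weak_lim_def fun_weak_lim_def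
      using assms C(1) by (intro conjI weak_bounds_rescale) auto
  qed
qed

end

section \<open>Averages and oscillations\<close>

lemma lesssim_mono: "lesssim c A B \<Longrightarrow> c \<le> d \<Longrightarrow> lesssim d A B"
  unfolding lesssim_def by (erule order_trans) (intro mult_right_mono ennreal_leI; simp)

lemma osc_nonneg: "0 \<le> osc f A"
  unfolding osc_def avg_def by (auto simp: set_lebesgue_integral_def intro!: mult_nonneg_nonneg integral_nonneg)

text \<open>Replacing the mean over \<open>A\<close> by the mean over \<open>B\<close> at most
  doubles the integral over \<open>A\<close> of the deviation; enlarging the domain to
  \<open>B\<close> and normalising by the other measure costs the factor \<open>K\<close>.\<close>

lemma osc_le:
  fixes f :: "real ^ 'n \<Rightarrow> 'b::{banach, second_countable_topology}"
  assumes AB: "A \<subseteq> B" "A \<in> sets borel" "B \<in> sets borel"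
    and fin: "emeasure lborel B < \<infinity>" and pos: "0 < measure lborel A"
    and f: "set_integrable lborel B f"
    and K: "measure lborel B \<le> K * measure lborel A"
  shows "osc f A \<le> 2 * K * osc f B"
proof -
  define c where "c = avg lborel f B"
  define d where "d = avg lborel f A"
  let ?a = "measure lborel A" and ?b = "measure lborel B"
  have finA: "emeasure lborel A < \<infinity>"
    using emeasure_mono[of A B lborel] AB fin by (auto intro: le_less_trans)
  have const: "set_integrable lborel E (\<lambda>_. x)" if "E \<in> sets borel" "emeasure lborel E < \<infinity>"
    for E :: "(real ^ 'n) set" and x :: 'b
    using that by (auto simp: set_integrable_def)
  have fA: "set_integrable lborel A f"
    using f AB by (intro set_integrable_subset[OF f]) auto
  have norm_int: "set_integrable lborel E (\<lambda>x. norm (f x - y))"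
    if "E \<in> sets borel" "emeasure lborel E < \<infinity>" "set_integrable lborel E f" for E y
    using that const by (intro set_integrable_norm set_integral_diff) auto
  define I where "I = (LINT x:A|lborel. norm (f x - c))"
  define J where "J = (LINT x:B|lborel. norm (f x - c))"
  \<comment> \<open>The difference of the means is the mean over \<open>A\<close> of
    \<open>f - c\<close>, so it is controlled by the same integral \<open>I\<close>.\<close>
  have "?a *\<^sub>R (d - c) = (LINT x:A|lborel. f x - c)"
    using AB finA fA const pos
    by (simp add: set_integral_diff set_integral_const d_def avg_def scaleR_diff_right)
  also have "norm \<dots> \<le> I"
    unfolding I_def using AB finA fA const by (intro set_integral_norm_bound set_integral_diff) auto
  finally have dc: "?a * norm (d - c) \<le> I"
    using pos by simp
  have IJ: "I \<le> J"
    unfolding I_def J_def set_lebesgue_integral_def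
    using norm_int[of A c] norm_int[of B c] AB fin finA f fA
    by (intro integral_mono) (auto simp: set_integrable_def indicator_def)
  have "(LINT x:A|lborel. norm (f x - d)) \<le> (LINT x:A|lborel. norm (f x - c) + norm (d - c))"
  proof (intro set_integral_mono set_integral_add norm_int)
    show "norm (f x - d) \<le> norm (f x - c) + norm (d - c)" for x
      using norm_triangle_ineq4[of "f x - c" "d - c"] by simp
    show "set_integrable lborel A (\<lambda>x. norm (d - c))"
      using AB finA by (auto simp: set_integrable_def)
  qed (use AB finA fA in auto)
  also have "\<dots> = I + ?a * norm (d - c)"
    using AB finA norm_int[of A c] fA
    by (subst set_integral_add) (auto simp: I_def set_integral_const set_integrable_def)
  also have "\<dots> \<le> 2 * J" using dc IJ by simp
  finally have "(LINT x:A|lborel. norm (f x - d)) / ?a \<le> 2 * J / ?a"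
    using pos by (intro divide_right_mono) auto
  moreover have "?b > 0"
    using pos measure_mono_fmeasurable[of A B lborel] AB fin by (auto simp: fmeasurable_def)
  then have "1 / ?a \<le> K / ?b"
    using K pos by (simp add: field_simps)
  then have "2 * J * (1 / ?a) \<le> 2 * J * (K / ?b)"
    using IJ order_trans[OF _ dc, of 0] pos by (intro mult_left_mono) auto
  ultimately show ?thesis
    by (simp add: osc_def avg_def c_def[symmetric, unfolded avg_def] d_def[symmetric, unfolded avg_def]
        J_def divide_inverse ac_simps)
qed

lemma dyadic_scale:
  assumes "0 < (t::real)"
  obtains k :: int where "2 powi k \<le> t" "t < 2 * 2 powi k"
proof -
  define k where "k = \<lfloor>log 2 t\<rfloor>"
  have "2 powr of_int k \<le> t" "t < 2 powr (of_int k + 1)"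
    using assms by (auto simp: k_def powr_le_iff less_powr_iff)
  then show ?thesis
    using that[of k] by (simp add: powr_real_of_int' powr_add)
qed

context doubling_space
begin

section \<open>Averages over balls and cubes\<close>

text \<open>For a nonnegative function the integral grows with the domain, and the ratio of the
  measures costs \<open>K\<close>.\<close>

lemma avg_le:
  fixes f :: "real ^ 'n \<Rightarrow> real"
  assumes AB: "A \<subseteq> B" "A \<in> sets borel" "B \<in> sets borel" and pos: "0 < measure \<mu> A"
    and f: "set_integrable \<mu> B f" and nonneg: "AE x in \<mu>. 0 \<le> f x"
    and fin: "emeasure \<mu> B < \<infinity>"
    and K: "measure \<mu> B \<le> K * measure \<mu> A"
  shows "avg \<mu> f A \<le> K * avg \<mu> f B"
proof -
  have fA: "set_integrable \<mu> A f" using AB by (intro set_integrable_subset[OF f]) auto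
  have le: "(LINT x:A|\<mu>. f x) \<le> (LINT x:B|\<mu>. f x)"
    unfolding set_lebesgue_integral_def using f fA nonneg AB
    by (intro integral_mono_AE) (auto simp: set_integrable_def indicator_def)
  have "0 \<le> (LINT x:B|\<mu>. f x)"
    unfolding set_lebesgue_integral_def using nonneg
    by (intro integral_nonneg_AE) (auto simp: indicator_def)
  moreover have "0 < measure \<mu> B"
    using pos measure_mono_fmeasurable[of A B \<mu>] AB fin by (auto simp: fmeasurable_def)
  then have "1 / measure \<mu> A \<le> K / measure \<mu> B"
    using K pos by (simp add: field_simps)
  ultimately have "(LINT x:A|\<mu>. f x) * (1 / measure \<mu> A) \<le> (LINT x:B|\<mu>. f x) * (K / measure \<mu> B)"
    using le pos by (intro mult_mono) auto
  then show ?thesis by (simp add: avg_def divide_inverse ac_simps)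
qed

lemma avg_nonneg:
  fixes f :: "real ^ 'n \<Rightarrow> real"
  assumes "AE x in \<mu>. 0 \<le> f x"
  shows "0 \<le> avg \<mu> f A"
proof -
  have "0 \<le> (LINT x:A|\<mu>. f x)"
    unfolding set_lebesgue_integral_def using assms
    by (intro integral_nonneg_AE) (auto simp: indicator_def)
  then show ?thesis by (simp add: avg_def)
qed

lemma measure_le_of_emeasure_le:
  assumes "emeasure \<mu> A \<le> ennreal K * emeasure \<mu> B" "emeasure \<mu> B < \<infinity>" "0 \<le> K"
  shows "measure \<mu> A \<le> K * measure \<mu> B"
proof -
  have "measure \<mu> A \<le> enn2real (ennreal K * emeasure \<mu> B)"
    unfolding measure_def using assms by (intro enn2real_mono) (auto simp: ennreal_mult_less_top)
  then show ?thesis using assms by (simp add: enn2real_mult measure_def)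
qed

lemma measure_pos: "0 < emeasure \<mu> A \<Longrightarrow> emeasure \<mu> A < \<infinity> \<Longrightarrow> 0 < measure \<mu> A"
  by (simp add: measure_def enn2real_positive_iff)

text \<open>The lower bound on \<open>t\<close> exceeds all distances within the cube, so the ball
  contains it; the upper bound keeps the ball in a neighbourhood of the cube whose measure doubling
  controls.\<close>

lemma cube_ball_comparable:
  obtains K where "0 < K"
    "\<And>Q x t. is_cube Q \<Longrightarrow> x \<in> Q \<Longrightarrow> of_nat CARD('n) * sidelength Q < t \<Longrightarrow>
      t < 2 * of_nat CARD('n) * sidelength Q \<Longrightarrow>
      Q \<subseteq> ball x t \<and> measure \<mu> (ball x t) \<le> K * measure \<mu> Q"
proof -
  obtain K where K: "0 < K" "\<And>Q. is_cube Q \<Longrightarrow>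
      emeasure \<mu> (nbhd (2 * of_nat CARD('n)) Q) \<le> ennreal K * emeasure \<mu> Q"
    by (rule nbhd_comparable[of "2 * of_nat CARD('n)"]) blast
  show ?thesis
  proof (rule that[OF K(1)])
    fix Q and x :: "real ^ 'n" and t :: real
    assume Q: "is_cube Q" "x \<in> Q" "of_nat CARD('n) * sidelength Q < t"
      "t < 2 * of_nat CARD('n) * sidelength Q"
    have "Q \<subseteq> ball x t" using dist_cube[OF Q(1,2)] Q(3) by force
    moreover have "ball x t \<subseteq> nbhd (2 * of_nat CARD('n)) Q"
      unfolding nbhd_def using Q by force
    then have "emeasure \<mu> (ball x t) \<le> emeasure \<mu> (nbhd (2 * of_nat CARD('n)) Q)"
      by (intro emeasure_mono) (simp_all add: nbhd_borel)
    with K(2)[OF Q(1)] have "emeasure \<mu> (ball x t) \<le> ennreal K * emeasure \<mu> Q" by simp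
    then have "measure \<mu> (ball x t) \<le> K * measure \<mu> Q"
      using K(1) cube_finite[OF Q(1)] by (intro measure_le_of_emeasure_le) auto
    ultimately show "Q \<subseteq> ball x t \<and> measure \<mu> (ball x t) \<le> K * measure \<mu> Q" ..
  qed
qed

text \<open>If every dyadic cube of side comparable to \<open>t\<close> meeting the ball had a much smaller average,
  then summing over these disjoint cubes would contradict doubling; so no bound on their
  number is needed.\<close>

lemma avg_ball_le_avg_cube:
  obtains K where "0 < K"
    "\<And>(f :: real ^ 'n \<Rightarrow> real) x t. locally_integrable \<mu> f \<Longrightarrow> AE x in \<mu>. 0 \<le> f x \<Longrightarrow> 0 < t \<Longrightarrow>
      \<exists>Q\<in>std_dyadic. x \<in> nbhd 2 Q \<and> 1 / 2 * sidelength Q < t \<and> t < 2 * sidelength Q \<and>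
        avg \<mu> f (ball x t) \<le> K * avg \<mu> f Q"
proof -
  define N :: real where "N = of_nat CARD('n)"
  \<comment> \<open>A cube of side at most \<open>t\<close> that meets the ball of radius
    \<open>t\<close> about \<open>x\<close> stays within distance \<open>(N + 1) * t\<close> of
    \<open>x\<close>.\<close>
  obtain K where K: "0 < K" "\<And>x r. 0 < r \<Longrightarrow> emeasure \<mu> (ball x ((N + 1) * r)) \<le> ennreal K * emeasure \<mu> (ball x r)"
    by (rule ball_comparable[of "N + 1"]) blast
  show ?thesis
  proof (rule that)
    show "0 < 2 * K" using K by simp
    fix f :: "real ^ 'n \<Rightarrow> real" and x :: "real ^ 'n" and t :: real
    assume f: "locally_integrable \<mu> f" and nonneg: "AE x in \<mu>. 0 \<le> f x" and t: "0 < t"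
    obtain k where k: "2 powi k \<le> t" "t < 2 * 2 powi k" using t by (rule dyadic_scale)
    define B where "B = ball x t"
    define S where "S = {Q \<in> std_dyadic :: (real ^ 'n) set set. sidelength Q = 2 powi k \<and> Q \<inter> B \<noteq> {}}"
    have cover: "\<exists>Q\<in>S. y \<in> Q" if "y \<in> B" for y
    proof -
      define Q :: "(real ^ 'n) set" where
        "Q = half_cube (\<chi> i. of_int \<lfloor>y $ i / 2 powi k\<rfloor> * 2 powi k) (2 powi k)"
      have "y \<in> Q" unfolding Q_def using std_dyadic_mem_iff[of y "\<lambda>i. \<lfloor>y $ i / 2 powi k\<rfloor>" k] by simp
      moreover have "Q \<in> std_dyadic" unfolding Q_def std_dyadic_def
        by (intro CollectI exI[of _ "\<lambda>i. \<lfloor>y $ i / 2 powi k\<rfloor>"] exI[of _ k]) simp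
      moreover have "sidelength Q = 2 powi k" by (simp add: Q_def sidelength_half_cube)
      ultimately show ?thesis using that by (auto simp: S_def)
    qed
    have S_ball: "Q \<subseteq> ball x ((N + 1) * t)" if "Q \<in> S" for Q
    proof
      fix z assume z: "z \<in> Q"
      obtain y where y: "y \<in> Q" "dist x y < t" using \<open>Q \<in> S\<close> by (auto simp: S_def B_def)
      have "dist y z < N * sidelength Q"
        unfolding N_def using that y z by (intro dist_cube) (auto simp: S_def std_dyadic_is_cube)
      also have "\<dots> \<le> N * t" using k that by (auto simp: S_def N_def)
      finally show "z \<in> ball x ((N + 1) * t)"
        using y dist_triangle[of x z y] by (simp add: algebra_simps)
    qed
    have cube: "is_cube Q" if "Q \<in> S" for Q using that by (auto simp: S_def std_dyadic_is_cube)
    have countable: "countable S"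
    proof (rule countable_subset)
      show "S \<subseteq> range (\<lambda>j :: 'n \<Rightarrow> int. half_cube (\<chi> i. of_int (j i) * 2 powi k) (2 powi k))"
      proof
        fix Q assume "Q \<in> S"
        then have Q: "Q \<in> std_dyadic" "sidelength Q = 2 powi k" by (auto simp: S_def)
        then obtain j l where "Q = half_cube (\<chi> i. of_int (j i) * 2 powi l) (2 powi l)"
          "sidelength Q = 2 powi l" by (auto elim: std_dyadicE)
        then show "Q \<in> range (\<lambda>j :: 'n \<Rightarrow> int. half_cube (\<chi> i. of_int (j i) * 2 powi k) (2 powi k))"
          using Q(2) by auto
      qed
    qed simp
    have Bpos: "0 < measure \<mu> B" unfolding B_def using t ball_pos ball_finite by (intro measure_pos)
    have "\<exists>Q\<in>S. avg \<mu> f B \<le> 2 * K * avg \<mu> f Q"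
    proof (rule ccontr)
      assume "\<not> ?thesis"
      then have neg: "2 * K * avg \<mu> f Q < avg \<mu> f B" if "Q \<in> S" for Q using that by auto
      \<comment> \<open>Taking \<open>f\<close> as a density turns its integrals into values of a
        measure, to which countable subadditivity over the cubes applies.\<close>
      define m where "m = density \<mu> (\<lambda>x. ennreal (f x))"
      have [measurable]: "f \<in> borel_measurable \<mu>" using f by (rule locally_integrable_measurable)
      have m: "emeasure m E = ennreal (avg \<mu> f E * measure \<mu> E)"
        if "E \<in> sets borel" "E \<subseteq> ball x r" "0 < measure \<mu> E" for E r
      proof -
        have "emeasure m E = (\<integral>\<^sup>+y. ennreal (indicator E y * f y) \<partial>\<mu>)"
          unfolding m_def using that
          by (subst emeasure_density) (auto intro!: nn_integral_cong simp: indicator_def)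
        also have "\<dots> = ennreal (LINT y:E|\<mu>. f y)"
          using locally_integrable_subset[OF f that(1,2)] nonneg
          by (subst nn_integral_eq_integral) (auto simp: set_integrable_def set_lebesgue_integral_def indicator_def)
        finally show ?thesis using that(3) by (simp add: avg_def field_simps)
      qed
      \<comment> \<open>By \<open>neg\<close> this threshold exceeds the average over every cube in
        \<open>S\<close>. The factor 2 leaves room for the contradiction after \<open>K\<close> is
        spent on doubling.\<close>
      define c where "c = avg \<mu> f B / (2 * K)"
      have c: "0 \<le> c" unfolding c_def using K avg_nonneg[OF nonneg] by simp
      have "emeasure m B \<le> emeasure m (\<Union>Q\<in>S. Q)"
      proof (rule emeasure_mono)
        show "B \<subseteq> (\<Union>Q\<in>S. Q)" using cover by blast
        show "(\<Union>Q\<in>S. Q) \<in> sets m"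
          using countable cube unfolding m_def sets_density
          by (intro sets.countable_UN') (auto simp: cube_borel)
      qed
      also have "\<dots> \<le> (\<Sum>\<^sub>\<infinity>Q\<in>S. emeasure m Q)"
        using countable cube by (intro emeasure_UN_le_infsum) (auto simp: m_def cube_borel)
      also have "\<dots> \<le> ennreal (c * K) * emeasure \<mu> B"
      proof (rule infsum_le_ennreal)
        fix A assume A: "finite A" "A \<subseteq> S"
        have "(\<Sum>Q\<in>A. emeasure m Q) \<le> (\<Sum>Q\<in>A. ennreal c * emeasure \<mu> Q)"
        proof (rule sum_mono)
          fix Q assume "Q \<in> A"
          then have Q: "Q \<in> S" using A by auto
          have "measure \<mu> Q > 0" using cube[OF Q] by (intro measure_pos cube_pos cube_finite)
          then have "emeasure m Q = ennreal (avg \<mu> f Q * measure \<mu> Q)"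
            using m[of Q] S_ball[OF Q] cube[OF Q] cube_borel by blast
          also have "\<dots> \<le> ennreal (c * measure \<mu> Q)"
            using neg[OF Q] K(1) by (intro ennreal_leI mult_right_mono) (auto simp: c_def field_simps)
          also have "\<dots> = ennreal c * emeasure \<mu> Q"
            using c cube_finite[OF cube[OF Q]] by (simp add: ennreal_mult emeasure_eq_ennreal_measure)
          finally show "emeasure m Q \<le> ennreal c * emeasure \<mu> Q" .
        qed
        also have "\<dots> = ennreal c * emeasure \<mu> (\<Union>Q\<in>A. Q)"
          unfolding sum_distrib_left[symmetric]
        proof (subst sum_emeasure)
          show "(\<lambda>Q. Q) ` A \<subseteq> sets \<mu>" using A cube by (auto simp: cube_borel)
          show "disjoint_family_on (\<lambda>Q. Q) A"
            unfolding disjoint_family_on_def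
          proof (intro ballI impI)
            fix P Q assume PQ: "P \<in> A" "Q \<in> A" "P \<noteq> Q"
            then have "P \<in> S" "Q \<in> S" using A by auto
            then have "P \<in> std_dyadic" "Q \<in> std_dyadic" "sidelength P = sidelength Q"
              by (simp_all add: S_def)
            with std_dyadic_eq[of P Q] PQ(3) show "P \<inter> Q = {}" by blast
          qed
        qed (use A in auto)
        also have "\<dots> \<le> ennreal c * (ennreal K * emeasure \<mu> B)"
        proof (rule mult_left_mono)
          have "emeasure \<mu> (\<Union>Q\<in>A. Q) \<le> emeasure \<mu> (ball x ((N + 1) * t))"
            using A S_ball by (intro emeasure_mono) auto
          also have "\<dots> \<le> ennreal K * emeasure \<mu> B" unfolding B_def using t by (rule K(2))
          finally show "emeasure \<mu> (\<Union>Q\<in>A. Q) \<le> ennreal K * emeasure \<mu> B" .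
        qed simp
        finally show "(\<Sum>Q\<in>A. emeasure m Q) \<le> ennreal (c * K) * emeasure \<mu> B"
          using c K by (simp add: ennreal_mult mult.assoc)
      qed
      also have "emeasure m B = ennreal (avg \<mu> f B * measure \<mu> B)"
        using m[of B t] Bpos by (auto simp: B_def)
      also have "ennreal (c * K) * emeasure \<mu> B = ennreal (c * K * measure \<mu> B)"
        using c K ball_finite[of x t] by (simp add: B_def ennreal_mult emeasure_eq_ennreal_measure)
      finally have "avg \<mu> f B * measure \<mu> B \<le> c * K * measure \<mu> B"
        using c K by (simp add: ennreal_le_iff)
      moreover have "c * K = avg \<mu> f B / 2" using K by (simp add: c_def)
      ultimately have "avg \<mu> f B \<le> avg \<mu> f B / 2"
        using mult_le_cancel_right_pos[OF Bpos] by metis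
      \<comment> \<open>The last inequality makes the average over \<open>B\<close> at most 0,
        whereas \<open>neg\<close> at the cube through \<open>x\<close>, whose average is
        nonnegative, makes it positive.\<close>
      moreover obtain Q where "Q \<in> S" using cover[of x] t by (auto simp: B_def)
      ultimately show False
        using neg[of Q] K avg_nonneg[OF nonneg, of Q] by (smt (verit) field_sum_of_halves mult_nonneg_nonneg)
    qed
    then obtain Q where Q: "Q \<in> S" "avg \<mu> f B \<le> 2 * K * avg \<mu> f Q" by blast
    then obtain y where y: "y \<in> Q" "dist x y < t" by (auto simp: S_def B_def)
    show "\<exists>Q\<in>std_dyadic. x \<in> nbhd 2 Q \<and> 1 / 2 * sidelength Q < t \<and> t < 2 * sidelength Q \<and>
        avg \<mu> f (ball x t) \<le> 2 * K * avg \<mu> f Q"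
    proof (intro bexI conjI)
      \<comment> \<open>The point \<open>y\<close> common to the cube and the ball has distance
        below \<open>t\<close>, hence below two side lengths, from \<open>x\<close>.\<close>
      show "x \<in> nbhd 2 Q" using y k Q by (auto simp: nbhd_def S_def dist_commute intro!: bexI[of _ y])
      show "1 / 2 * sidelength Q < t" using Q k t by (simp add: S_def)
      show "t < 2 * sidelength Q" using Q k by (simp add: S_def)
    qed (use Q in \<open>auto simp: S_def B_def\<close>)
  qed
qed

end

section \<open>Comparison of the weak quantities for averages\<close>

context doubling_space
begin

lemma a_fun_measurable:
  fixes f :: "real ^ 'n \<Rightarrow> real"
  assumes "locally_integrable \<mu> f"
  shows "a_fun p \<gamma> \<mu> f \<in> borel_measurable (nu \<mu> \<gamma>')"
proof -
  have [measurable]: "f \<in> borel_measurable \<mu>" using assms by (rule locally_integrable_measurable)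
  show ?thesis
    using powr_mult_nu_measurable[OF avg_ball_measurable[of "\<lambda>w. f (snd w)"], of "\<gamma> / p"]
    by (simp add: a_fun_def)
qed

text \<open>\<open>K1\<close> and \<open>K2\<close> bound the sequence by the function,
  \<open>K3\<close> and \<open>K4\<close> the function by the sequence. In each pair the first
  constant accounts for the power of the scale and the second for the average.\<close>

lemma a_weak_approx:
  assumes p: "1 \<le> p"
  obtains c where "0 < c"
    "\<And>f :: real ^ 'n \<Rightarrow> real. locally_integrable \<mu> f \<Longrightarrow> AE x in \<mu>. 0 \<le> f x \<Longrightarrow>
      approx c (seq_weak_norm p \<gamma> \<mu> std_dyadic (a_seq p \<gamma> \<mu> f)) (fun_weak_norm p \<gamma> \<mu> (a_fun p \<gamma> \<mu> f)) \<and>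
      approx c (seq_weak_lim p \<gamma> \<mu> std_dyadic (a_seq p \<gamma> \<mu> f)) (fun_weak_lim p \<gamma> \<mu> (a_fun p \<gamma> \<mu> f))"
proof -
  define N :: real where "N = of_nat CARD('n)"
  have N: "0 < N" "N < 2 * N" by (simp_all add: N_def)
  have half: "0 < 1 / (2 :: real)" "1 / 2 < (2 :: real)" by simp_all
  obtain K1 where K1: "0 < K1"
    "\<And>s t. 0 < s \<Longrightarrow> N * s \<le> t \<Longrightarrow> t \<le> 2 * N * s \<Longrightarrow> s powr (\<gamma> / p) \<le> K1 * t powr (\<gamma> / p)"
    by (rule powr_comparable[OF N, of "\<gamma> / p"]) blast
  obtain K2 where K2: "0 < K2" "\<And>Q x t. is_cube Q \<Longrightarrow> x \<in> Q \<Longrightarrow> N * sidelength Q < t \<Longrightarrow>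
      t < 2 * N * sidelength Q \<Longrightarrow> Q \<subseteq> ball x t \<and> measure \<mu> (ball x t) \<le> K2 * measure \<mu> Q"
    unfolding N_def by (rule cube_ball_comparable) blast
  obtain K3 where K3: "0 < K3"
    "\<And>s t. 0 < s \<Longrightarrow> 1 / 2 * s \<le> t \<Longrightarrow> t \<le> 2 * s \<Longrightarrow> t powr (\<gamma> / p) \<le> K3 * s powr (\<gamma> / p)"
    by (rule powr_comparable[OF half, of "\<gamma> / p"]) blast
  obtain K4 where K4: "0 < K4"
    "\<And>(f :: real ^ 'n \<Rightarrow> real) x t. locally_integrable \<mu> f \<Longrightarrow> AE x in \<mu>. 0 \<le> f x \<Longrightarrow> 0 < t \<Longrightarrow>
      \<exists>Q\<in>std_dyadic. x \<in> nbhd 2 Q \<and> 1 / 2 * sidelength Q < t \<and> t < 2 * sidelength Q \<and>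
        avg \<mu> f (ball x t) \<le> K4 * avg \<mu> f Q"
    by (rule avg_ball_le_avg_cube) blast
  obtain c1 where c1: "0 < c1"
    "\<And>s F. F \<in> borel_measurable (nu \<mu> \<gamma>) \<Longrightarrow>
      (\<And>Q x t. Q \<in> std_dyadic \<Longrightarrow> x \<in> Q \<Longrightarrow> N * sidelength Q < t \<Longrightarrow>
        t < 2 * N * sidelength Q \<Longrightarrow> \<bar>s Q\<bar> \<le> (K1 * K2) * \<bar>F (x, t)\<bar>) \<Longrightarrow>
      lesssim c1 (seq_weak_norm p \<gamma> \<mu> std_dyadic s) (fun_weak_norm p \<gamma> \<mu> F) \<and>
      lesssim c1 (seq_weak_lim p \<gamma> \<mu> std_dyadic s) (fun_weak_lim p \<gamma> \<mu> F)"
    unfolding N_def by (rule seq_weak_le_fun_weak[OF p mult_pos_pos[OF K1(1) K2(1)], of \<gamma>]) blast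
  obtain c2 where c2: "0 < c2"
    "\<And>D s F. (\<And>Q. Q \<in> D \<Longrightarrow> is_cube Q) \<Longrightarrow>
      (\<And>x t. 0 < t \<Longrightarrow> \<exists>Q\<in>D. x \<in> nbhd 2 Q \<and> 1 / 2 * sidelength Q < t \<and> t < 2 * sidelength Q \<and>
        \<bar>F (x, t)\<bar> \<le> (K3 * K4) * \<bar>s Q\<bar>) \<Longrightarrow>
      lesssim c2 (fun_weak_norm p \<gamma> \<mu> F) (seq_weak_norm p \<gamma> \<mu> D s) \<and>
      lesssim c2 (fun_weak_lim p \<gamma> \<mu> F) (seq_weak_lim p \<gamma> \<mu> D s)"
    by (rule fun_weak_le_seq_weak[OF half p mult_pos_pos[OF K3(1) K4(1)], of \<gamma>]) blast
  show ?thesis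
  proof (rule that)
    show "0 < max c1 c2" using c1 by simp
    fix f :: "real ^ 'n \<Rightarrow> real"
    assume f: "locally_integrable \<mu> f" and nonneg: "AE x in \<mu>. 0 \<le> f x"
    have "\<bar>a_seq p \<gamma> \<mu> f Q\<bar> \<le> (K1 * K2) * \<bar>a_fun p \<gamma> \<mu> f (x, t)\<bar>"
      if Q: "Q \<in> std_dyadic" "x \<in> Q" "N * sidelength Q < t" "t < 2 * N * sidelength Q" for Q x t
    proof -
      have cube: "is_cube Q" using Q(1) by (rule std_dyadic_is_cube)
      have "avg \<mu> f Q \<le> K2 * avg \<mu> f (ball x t)"
      proof (rule avg_le)
        show "set_integrable \<mu> (ball x t) f" using f by (rule locally_integrable_subset) auto
        show "0 < measure \<mu> Q" using cube by (intro measure_pos cube_pos cube_finite)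
      qed (use K2(2)[OF cube Q(2-4)] cube nonneg ball_finite in \<open>auto simp: cube_borel\<close>)
      moreover have "sidelength Q powr (\<gamma> / p) \<le> K1 * t powr (\<gamma> / p)"
        using Q sidelength_pos[OF cube] by (intro K1(2)) auto
      ultimately have "sidelength Q powr (\<gamma> / p) * avg \<mu> f Q \<le>
          (K1 * t powr (\<gamma> / p)) * (K2 * avg \<mu> f (ball x t))"
        using K1(1) K2(1) avg_nonneg[OF nonneg] by (intro mult_mono) auto
      then show ?thesis
        using avg_nonneg[OF nonneg] by (simp add: a_seq_def a_fun_def abs_mult ac_simps)
    qed
    then have 1: "lesssim c1 (seq_weak_norm p \<gamma> \<mu> std_dyadic (a_seq p \<gamma> \<mu> f)) (fun_weak_norm p \<gamma> \<mu> (a_fun p \<gamma> \<mu> f)) \<and>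
      lesssim c1 (seq_weak_lim p \<gamma> \<mu> std_dyadic (a_seq p \<gamma> \<mu> f)) (fun_weak_lim p \<gamma> \<mu> (a_fun p \<gamma> \<mu> f))"
      by (intro c1(2) a_fun_measurable f)
    have "\<exists>Q\<in>std_dyadic. x \<in> nbhd 2 Q \<and> 1 / 2 * sidelength Q < t \<and> t < 2 * sidelength Q \<and>
        \<bar>a_fun p \<gamma> \<mu> f (x, t)\<bar> \<le> (K3 * K4) * \<bar>a_seq p \<gamma> \<mu> f Q\<bar>" if t: "0 < t" for x t
    proof -
      obtain Q where Q: "Q \<in> std_dyadic" "x \<in> nbhd 2 Q" "1 / 2 * sidelength Q < t" "t < 2 * sidelength Q"
        "avg \<mu> f (ball x t) \<le> K4 * avg \<mu> f Q"
        using K4(2)[OF f nonneg t, of x] by blast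
      have "t powr (\<gamma> / p) \<le> K3 * sidelength Q powr (\<gamma> / p)"
        using Q sidelength_pos[OF std_dyadic_is_cube[OF Q(1)]] by (intro K3(2)) auto
      then have "t powr (\<gamma> / p) * avg \<mu> f (ball x t) \<le>
          (K3 * sidelength Q powr (\<gamma> / p)) * (K4 * avg \<mu> f Q)"
        using K3(1) Q(5) avg_nonneg[OF nonneg] by (intro mult_mono) auto
      then have "\<bar>a_fun p \<gamma> \<mu> f (x, t)\<bar> \<le> (K3 * K4) * \<bar>a_seq p \<gamma> \<mu> f Q\<bar>"
        using avg_nonneg[OF nonneg] by (simp add: a_seq_def a_fun_def abs_mult ac_simps)
      with Q show ?thesis by blast
    qed
    then have "lesssim c2 (fun_weak_norm p \<gamma> \<mu> (a_fun p \<gamma> \<mu> f)) (seq_weak_norm p \<gamma> \<mu> std_dyadic (a_seq p \<gamma> \<mu> f)) \<and>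
      lesssim c2 (fun_weak_lim p \<gamma> \<mu> (a_fun p \<gamma> \<mu> f)) (seq_weak_lim p \<gamma> \<mu> std_dyadic (a_seq p \<gamma> \<mu> f))"
      by (intro c2(2) std_dyadic_is_cube)
    with 1 show "approx (max c1 c2) (seq_weak_norm p \<gamma> \<mu> std_dyadic (a_seq p \<gamma> \<mu> f)) (fun_weak_norm p \<gamma> \<mu> (a_fun p \<gamma> \<mu> f)) \<and>
      approx (max c1 c2) (seq_weak_lim p \<gamma> \<mu> std_dyadic (a_seq p \<gamma> \<mu> f)) (fun_weak_lim p \<gamma> \<mu> (a_fun p \<gamma> \<mu> f))"
      unfolding approx_def by (auto intro: lesssim_mono)
  qed
qed

end

section \<open>Radon measures, Lebesgue measure and the covering family\<close>

lemma doubling_space_radon: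
  assumes "radon_measure \<mu>" "doubling_measure \<mu>"
  shows "doubling_space \<mu>"
proof
  show "sets \<mu> = sets borel" using assms by (simp add: radon_measure_def)
  show "emeasure \<mu> (ball x r) < \<infinity>" for x r
  proof -
    have "emeasure \<mu> (ball x r) \<le> emeasure \<mu> (cball x r)"
      using \<open>sets \<mu> = sets borel\<close> by (intro emeasure_mono) auto
    also have "\<dots> < \<infinity>" using assms(1) compact_cball[of x r] unfolding radon_measure_def by blast
    finally show ?thesis .
  qed
qed fact

interpretation lborel: doubling_space "lborel :: (real ^ 'n) measure"
proof
  show "emeasure lborel (ball x r) < \<infinity>" for x :: "real ^ 'n" and r
    by (rule emeasure_bounded_finite) simp
  show "doubling_measure (lborel :: (real ^ 'n) measure)"
    unfolding doubling_measure_def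
  proof (intro exI allI impI conjI)
    fix x :: "real ^ 'n" and r :: real assume r: "0 < r"
    have *: "emeasure lborel (ball x s) = ennreal (measure lborel (ball x s))" for s
      by (intro emeasure_eq_ennreal_measure) (use emeasure_bounded_finite[of "ball x s"] in auto)
    show "0 < emeasure lborel (ball x (2 * r))"
      using r unfolding * by simp
    have "measure lborel (ball x (2 * r)) = 2 ^ DIM(real ^ 'n) * measure lborel (ball x r)"
      using content_ball[of "2 * r" x] content_ball[of r x] r by (simp add: power_mult_distrib)
    then show "emeasure lborel (ball x (2 * r)) \<le> ennreal (2 ^ DIM(real ^ 'n)) * emeasure lborel (ball x r)"
      unfolding * by (simp add: ennreal_mult)
  qed
qed simp

text \<open>Measurability is obtained in two passes: the mean over the ball is measurable in centre
  and radius, and it then enters the integrand of the outer average as a parameter.\<close>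

lemma osc_ball_measurable:
  fixes f :: "real ^ 'n \<Rightarrow> 'b::{banach, second_countable_topology}"
  assumes "locally_integrable lborel f"
  shows "(\<lambda>(x, t). t powr q * osc f (ball x t)) \<in> borel_measurable (nu lborel \<gamma>)"
proof -
  let ?N = "lborel \<Otimes>\<^sub>M restrict_space lborel {0<..} :: ((real ^ 'n) \<times> real) measure"
  have [measurable]: "f \<in> borel_measurable lborel"
    using assms by (rule lborel.locally_integrable_measurable)
  have [measurable]: "(\<lambda>z. avg lborel f (ball (fst z) (snd z))) \<in> borel_measurable ?N"
    using lborel.avg_ball_measurable[of "\<lambda>w. f (snd w)"] by simp
  have "(\<lambda>z. avg lborel (\<lambda>y. norm (f y - avg lborel f (ball (fst z) (snd z)))) (ball (fst z) (snd z)))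
      \<in> borel_measurable ?N"
    using lborel.avg_ball_measurable[of "\<lambda>w. norm (f (snd w) - avg lborel f (ball (fst (fst w)) (snd (fst w))))"]
    by simp
  then show ?thesis
    using lborel.powr_mult_nu_measurable[of "\<lambda>z. osc f (ball (fst z) (snd z))" q \<gamma>] by (simp add: osc_def)
qed

text \<open>Comparable volumes force comparable scales: the volume bound, read on the inscribed ball
  of the cube, limits the side length from above, and two distant points of the contained ball limit
  it from below.\<close>

lemma covering_ball:
  fixes D :: "nat \<Rightarrow> (real ^ 'n) set set"
  assumes "ball_covering_family D"
  obtains C \<alpha> where "0 < C" "0 < \<alpha>" "\<alpha> < 2 * of_nat CARD('n)"
    "\<And>x t. 0 < t \<Longrightarrow> \<exists>j\<in>{1..CARD('n) + 1}. \<exists>Q\<in>D j. is_cube Q \<and> ball x t \<subseteq> Q \<and>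
      measure lborel Q \<le> C * measure lborel (ball x t) \<and>
      \<alpha> * sidelength Q < t \<and> t < 2 * of_nat CARD('n) * sidelength Q"
proof -
  define N where "N = CARD('n)"
  have N: "0 < N" by (simp add: N_def)
  obtain C0 where C0: "\<And>x r. 0 < r \<Longrightarrow> \<exists>j\<in>{1..CARD('n) + 1}. \<exists>Q\<in>D j. ball x r \<subseteq> Q \<and>
      measure lborel Q \<le> C0 * measure lborel (ball x r)"
    using assms unfolding ball_covering_family_def by blast
  \<comment> \<open>A constant of at least 1 is below its own powers, which is used when a root is
    taken.\<close>
  define C where "C = max C0 1"
  have C: "1 \<le> C" by (simp add: C_def)
  show ?thesis
  proof (rule that[of C "1 / (4 * C)"])
    show "1 / (4 * C) < 2 * of_nat CARD('n)"
    proof -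
      have "1 / (4 * C) \<le> 1 / 4" using C by (simp add: field_simps)
      moreover have "1 \<le> real CARD('n)" using N unfolding N_def by linarith
      ultimately show ?thesis by linarith
    qed
    fix x :: "real ^ 'n" and t :: real assume t: "0 < t"
    obtain j Q where jQ: "j \<in> {1..CARD('n) + 1}" "Q \<in> D j" "ball x t \<subseteq> Q"
      "measure lborel Q \<le> C0 * measure lborel (ball x t)"
      using C0[OF t, of x] by blast
    have cube: "is_cube Q"
      using assms jQ unfolding ball_covering_family_def dyadic_system_def by blast
    have "C0 * measure lborel (ball x t) \<le> C * measure lborel (ball x t)"
      by (intro mult_right_mono) (auto simp: C_def)
    then have le: "measure lborel Q \<le> C * measure lborel (ball x t)" using jQ by linarith
    obtain c where c: "ball c (sidelength Q / 2) \<subseteq> Q" using cube by (rule cube_contains_ball)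
    have "measure lborel (ball c (sidelength Q / 2)) \<le> measure lborel Q"
      using c cube lborel.cube_finite[OF cube]
      by (intro measure_mono_fmeasurable) (auto simp: fmeasurable_def cube_borel)
    moreover have "measure lborel (ball c (sidelength Q / 2)) = unit_ball_vol N * (sidelength Q / 2) ^ N"
      "measure lborel (ball x t) = unit_ball_vol N * t ^ N"
      using t sidelength_pos[OF cube] by (simp_all add: content_ball N_def)
    ultimately have "unit_ball_vol N * (sidelength Q / 2) ^ N \<le> C * (unit_ball_vol N * t ^ N)"
      using le by (metis order_trans)
    then have "(sidelength Q / 2) ^ N \<le> C * t ^ N"
      using unit_ball_vol_pos[of "real N"] by (simp add: mult.left_commute[of C])
    \<comment> \<open>Since \<open>C \<le> C ^ N\<close>, both sides become \<open>N\<close>-th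
      powers and fractional exponents are avoided.\<close>
    also have "\<dots> \<le> C ^ N * t ^ N"
      using C N t by (intro mult_right_mono) (auto intro: self_le_power)
    finally have "(sidelength Q / 2) ^ N \<le> (C * t) ^ N" by (simp add: power_mult_distrib)
    then have "sidelength Q / 2 \<le> C * t"
      using C t N sidelength_pos[OF cube] by (subst (asm) power_mono_iff) auto
    moreover have "0 < C * t" using C t by simp
    \<comment> \<open>The estimate itself gives \<open>2 * C * t\<close>; the spare factor 2 makes
      the inequality strict.\<close>
    ultimately have "sidelength Q < t * (4 * C)" by (simp add: algebra_simps)
    then have "1 / (4 * C) * sidelength Q < t"
      using C by (simp add: divide_less_eq)
    moreover have "t < 2 * of_nat CARD('n) * sidelength Q"
    proof -
      \<comment> \<open>A second point of the ball, half a radius from \<open>x\<close> along a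
        coordinate axis; \<open>undefined\<close> just names some coordinate.\<close>
      define y where "y = x + (t / 2) *\<^sub>R axis undefined 1"
      have d: "dist x y = t / 2" using t by (simp add: y_def dist_norm norm_axis_1)
      then have "x \<in> Q" "y \<in> Q" using jQ(3) t by auto
      then show ?thesis using dist_cube[OF cube, of x y] d by simp
    qed
    ultimately show "\<exists>j\<in>{1..CARD('n) + 1}. \<exists>Q\<in>D j. is_cube Q \<and> ball x t \<subseteq> Q \<and>
      measure lborel Q \<le> C * measure lborel (ball x t) \<and>
      1 / (4 * C) * sidelength Q < t \<and> t < 2 * of_nat CARD('n) * sidelength Q"
      using jQ cube le by blast
  qed (use C in auto)
qed

text \<open>The exponent \<open>q\<close> is kept apart from \<open>\<gamma>\<close>:
  \<open>q = \<gamma> / p\<close> yields the weighted oscillations, and \<open>q = 0\<close> with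
  weight exponent \<open>p\<close> the unweighted ones.\<close>

lemma osc_weak_bounds:
  fixes D :: "nat \<Rightarrow> (real ^ 'n) set set"
  assumes p: "1 \<le> p" and D: "ball_covering_family D"
  obtains c where "0 < c"
    "\<And>f :: real ^ 'n \<Rightarrow> 'b::{banach, second_countable_topology}. locally_integrable lborel f \<Longrightarrow>
      lesssim c (seq_weak_norm p \<gamma> lborel std_dyadic (\<lambda>Q. sidelength Q powr q * osc f Q))
        (fun_weak_norm p \<gamma> lborel (\<lambda>(x, t). t powr q * osc f (ball x t))) \<and>
      lesssim c (fun_weak_norm p \<gamma> lborel (\<lambda>(x, t). t powr q * osc f (ball x t)))
        (MAX j\<in>{1..CARD('n) + 1}. seq_weak_norm p \<gamma> lborel (D j) (\<lambda>Q. sidelength Q powr q * osc f Q))"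
proof -
  define N :: real where "N = of_nat CARD('n)"
  have N: "0 < N" "N < 2 * N" by (simp_all add: N_def)
  obtain K1 where K1: "0 < K1"
    "\<And>s t. 0 < s \<Longrightarrow> N * s \<le> t \<Longrightarrow> t \<le> 2 * N * s \<Longrightarrow> s powr q \<le> K1 * t powr q"
    by (rule powr_comparable[OF N, of q]) blast
  obtain K2 where K2: "0 < K2" "\<And>(Q :: (real ^ 'n) set) x t. is_cube Q \<Longrightarrow> x \<in> Q \<Longrightarrow> N * sidelength Q < t \<Longrightarrow>
      t < 2 * N * sidelength Q \<Longrightarrow> Q \<subseteq> ball x t \<and> measure lborel (ball x t) \<le> K2 * measure lborel Q"
    unfolding N_def by (rule lborel.cube_ball_comparable) blast
  obtain C \<alpha> where C: "0 < C" and \<alpha>: "0 < \<alpha>" "\<alpha> < 2 * N"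
    and cov: "\<And>x t. 0 < t \<Longrightarrow> \<exists>j\<in>{1..CARD('n) + 1}. \<exists>Q\<in>D j. is_cube Q \<and> ball x t \<subseteq> Q \<and>
      measure lborel Q \<le> C * measure lborel (ball x t) \<and> \<alpha> * sidelength Q < t \<and> t < 2 * N * sidelength Q"
    unfolding N_def using D by (rule covering_ball) blast
  obtain K3 where K3: "0 < K3"
    "\<And>s t. 0 < s \<Longrightarrow> \<alpha> * s \<le> t \<Longrightarrow> t \<le> 2 * N * s \<Longrightarrow> t powr q \<le> K3 * s powr q"
    by (rule powr_comparable[OF \<alpha>, of q]) blast
  \<comment> \<open>In each constant the factor 2 is the one from \<open>osc_le\<close>, and the
    other two account for the power of the scale and the ratio of volumes.\<close>
  have pos: "0 < K1 * (2 * K2)" "0 < K3 * (2 * C)" using K1 K2 K3 C by auto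
  obtain c1 where c1: "0 < c1"
    "\<And>(s :: (real ^ 'n) set \<Rightarrow> real) F. F \<in> borel_measurable (nu lborel \<gamma>) \<Longrightarrow>
      (\<And>Q x t. Q \<in> std_dyadic \<Longrightarrow> x \<in> Q \<Longrightarrow> N * sidelength Q < t \<Longrightarrow>
        t < 2 * N * sidelength Q \<Longrightarrow> \<bar>s Q\<bar> \<le> (K1 * (2 * K2)) * \<bar>F (x, t)\<bar>) \<Longrightarrow>
      lesssim c1 (seq_weak_norm p \<gamma> lborel std_dyadic s) (fun_weak_norm p \<gamma> lborel F)"
    unfolding N_def by (rule lborel.seq_weak_le_fun_weak[OF p pos(1), of \<gamma>]) blast
  obtain c2 where c2: "0 < c2"
    "\<And>(D :: nat \<Rightarrow> (real ^ 'n) set set) s F. (\<And>j Q. j \<in> {1..CARD('n) + 1} \<Longrightarrow> Q \<in> D j \<Longrightarrow> is_cube Q) \<Longrightarrow>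
      (\<And>x t. 0 < t \<Longrightarrow> \<exists>j\<in>{1..CARD('n) + 1}. \<exists>Q\<in>D j. x \<in> nbhd (2 * N) Q \<and> \<alpha> * sidelength Q < t \<and>
        t < 2 * N * sidelength Q \<and> \<bar>F (x, t)\<bar> \<le> (K3 * (2 * C)) * \<bar>s Q\<bar>) \<Longrightarrow>
      lesssim c2 (fun_weak_norm p \<gamma> lborel F) (MAX j\<in>{1..CARD('n) + 1}. seq_weak_norm p \<gamma> lborel (D j) s)"
    by (rule lborel.fun_weak_le_Max_seq_weak[OF \<alpha> p pos(2), of "{1..CARD('n) + 1}" \<gamma>]) (simp, simp, blast)
  show ?thesis
  proof (rule that)
    show "0 < max c1 c2" using c1 by simp
    fix f :: "real ^ 'n \<Rightarrow> 'b" assume f: "locally_integrable lborel f"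
    let ?s = "\<lambda>Q. sidelength Q powr q * osc f Q" and ?F = "\<lambda>(x, t). t powr q * osc f (ball x t)"
    have "\<bar>?s Q\<bar> \<le> (K1 * (2 * K2)) * \<bar>?F (x, t)\<bar>"
      if Q: "Q \<in> std_dyadic" "x \<in> Q" "N * sidelength Q < t" "t < 2 * N * sidelength Q" for Q x t
    proof -
      have cube: "is_cube Q" using Q(1) by (rule std_dyadic_is_cube)
      have "osc f Q \<le> 2 * K2 * osc f (ball x t)"
      proof (rule osc_le)
        show "set_integrable lborel (ball x t) f" using f by (rule lborel.locally_integrable_subset) auto
        show "0 < measure lborel Q" using cube by (intro lborel.measure_pos lborel.cube_pos lborel.cube_finite)
      qed (use K2(2)[OF cube Q(2-4)] cube lborel.ball_finite in \<open>auto simp: cube_borel\<close>)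
      moreover have "sidelength Q powr q \<le> K1 * t powr q"
        using Q sidelength_pos[OF cube] by (intro K1(2)) auto
      ultimately have "sidelength Q powr q * osc f Q \<le> (K1 * t powr q) * (2 * K2 * osc f (ball x t))"
        using K1(1) K2(1) by (intro mult_mono) (auto simp: osc_nonneg)
      then show ?thesis
        by (simp add: abs_mult osc_nonneg ac_simps)
    qed
    then have 1: "lesssim c1 (seq_weak_norm p \<gamma> lborel std_dyadic ?s) (fun_weak_norm p \<gamma> lborel ?F)"
      by (intro c1(2) osc_ball_measurable f)
    have "\<exists>j\<in>{1..CARD('n) + 1}. \<exists>Q\<in>D j. x \<in> nbhd (2 * N) Q \<and> \<alpha> * sidelength Q < t \<and>
        t < 2 * N * sidelength Q \<and> \<bar>?F (x, t)\<bar> \<le> (K3 * (2 * C)) * \<bar>?s Q\<bar>" if t: "0 < t" for x t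
    proof -
      obtain j Q where Q: "j \<in> {1..CARD('n) + 1}" "Q \<in> D j" "is_cube Q" "ball x t \<subseteq> Q"
        "measure lborel Q \<le> C * measure lborel (ball x t)" "\<alpha> * sidelength Q < t" "t < 2 * N * sidelength Q"
        using cov[OF t, of x] by blast
      have "osc f (ball x t) \<le> 2 * C * osc f Q"
      proof (rule osc_le)
        obtain c r where "Q \<subseteq> ball c r" using lborel.cube_subset_ball[OF Q(3)] .
        then show "set_integrable lborel Q f"
          using cube_borel[OF Q(3)] by (intro lborel.locally_integrable_subset[OF f])
        show "0 < measure lborel (ball x t)"
          using t by (intro lborel.measure_pos lborel.ball_pos lborel.ball_finite)
      qed (use Q lborel.cube_finite[OF Q(3)] in \<open>auto simp: cube_borel\<close>)
      moreover have "t powr q \<le> K3 * sidelength Q powr q"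
        using Q sidelength_pos[OF Q(3)] by (intro K3(2)) auto
      ultimately have "t powr q * osc f (ball x t) \<le> (K3 * sidelength Q powr q) * (2 * C * osc f Q)"
        using K3(1) C by (intro mult_mono) (auto simp: osc_nonneg)
      then have "\<bar>?F (x, t)\<bar> \<le> (K3 * (2 * C)) * \<bar>?s Q\<bar>"
        by (simp add: abs_mult osc_nonneg ac_simps)
      moreover have "x \<in> nbhd (2 * N) Q"
        using Q(4) t N sidelength_pos[OF Q(3)] by (auto simp: nbhd_def intro!: bexI[of _ x])
      ultimately show ?thesis using Q by blast
    qed
    moreover have "is_cube Q" if "j \<in> {1..CARD('n) + 1}" "Q \<in> D j" for j Q
      using D that unfolding ball_covering_family_def dyadic_system_def by blast
    ultimately have "lesssim c2 (fun_weak_norm p \<gamma> lborel ?F)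
        (MAX j\<in>{1..CARD('n) + 1}. seq_weak_norm p \<gamma> lborel (D j) ?s)"
      by (intro c2(2))
    with 1 show "lesssim (max c1 c2) (seq_weak_norm p \<gamma> lborel std_dyadic ?s) (fun_weak_norm p \<gamma> lborel ?F) \<and>
      lesssim (max c1 c2) (fun_weak_norm p \<gamma> lborel ?F)
        (MAX j\<in>{1..CARD('n) + 1}. seq_weak_norm p \<gamma> lborel (D j) ?s)"
      by (auto intro: lesssim_mono)
  qed
qed

section \<open>Reduction of the unweighted oscillations and assembly\<close>

text \<open>Only positive \<open>t\<close> occur in the space of \<open>nu\<close>. This allows a
  factor \<open>t powr 0\<close> to be inserted, whose value is 0 at \<open>t = 0\<close>.\<close>

lemma fun_weak_norm_cong:
  assumes "\<And>x t. 0 < t \<Longrightarrow> F (x, t) = G (x, t)"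
  shows "fun_weak_norm p \<gamma> \<mu> F = fun_weak_norm p \<gamma> \<mu> G"
proof -
  have "{z \<in> space (nu \<mu> \<gamma>). l < \<bar>F z\<bar>} = {z \<in> space (nu \<mu> \<gamma>). l < \<bar>G z\<bar>}" for l
    using assms by (auto simp: nu_def space_pair_measure space_restrict_space)
  then show ?thesis by (simp add: fun_weak_norm_def fun_distr_def)
qed

text \<open>Cubes have positive side length, so the factor \<open>sidelength Q powr 0\<close> equals
  1 and the level sets agree.\<close>

lemma osc_norm_eq_seq_weak_norm:
  assumes "\<And>Q. Q \<in> D \<Longrightarrow> is_cube Q"
  shows "osc_norm p D f = seq_weak_norm p p lborel D (\<lambda>Q. sidelength Q powr 0 * osc f Q)"
proof -
  have "{Q \<in> D. l < osc f Q} = {Q \<in> D. l < \<bar>sidelength Q powr 0 * osc f Q\<bar>}" for l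
    using assms sidelength_pos osc_nonneg[of f] by (fastforce simp: abs_mult)
  then show ?thesis by (simp add: osc_norm_def seq_weak_norm_def seq_distr_def)
qed

theorem proposition6p2:
  fixes p \<gamma> :: real
  assumes "1 \<le> p" and "\<gamma> \<noteq> 0"
  shows
    "(\<forall>\<mu> :: (real ^ 'n) measure. radon_measure \<mu> \<and> doubling_measure \<mu> \<longrightarrow>
       (\<exists>c>0. \<forall>f :: real ^ 'n \<Rightarrow> real. locally_integrable \<mu> f \<and> (AE x in \<mu>. 0 \<le> f x) \<longrightarrow>
          approx c (seq_weak_norm p \<gamma> \<mu> std_dyadic (a_seq p \<gamma> \<mu> f))
                   (fun_weak_norm p \<gamma> \<mu> (a_fun p \<gamma> \<mu> f)) \<and>
          approx c (seq_weak_lim p \<gamma> \<mu> std_dyadic (a_seq p \<gamma> \<mu> f))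
                   (fun_weak_lim p \<gamma> \<mu> (a_fun p \<gamma> \<mu> f))))
     \<and>
     (\<forall>D :: nat \<Rightarrow> (real ^ 'n) set set. ball_covering_family D \<longrightarrow>
       (\<exists>c>0. \<forall>f :: real ^ 'n \<Rightarrow> complex. locally_integrable lborel f \<longrightarrow>
          lesssim c (seq_weak_norm p \<gamma> lborel std_dyadic (b_seq p \<gamma> f))
                    (fun_weak_norm p \<gamma> lborel (b_fun p \<gamma> f)) \<and>
          lesssim c (fun_weak_norm p \<gamma> lborel (b_fun p \<gamma> f))
                    (MAX j\<in>{1..CARD('n) + 1}. seq_weak_norm p \<gamma> lborel (D j) (b_seq p \<gamma> f))))
     \<and>
     (\<forall>D :: nat \<Rightarrow> (real ^ 'n) set set. ball_covering_family D \<longrightarrow>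
       (\<exists>c>0. \<forall>f :: real ^ 'n \<Rightarrow> complex. locally_integrable lborel f \<longrightarrow>
          lesssim c (osc_norm p std_dyadic f) (fun_weak_norm p p lborel (m_fun f)) \<and>
          lesssim c (fun_weak_norm p p lborel (m_fun f))
                    (MAX j\<in>{1..CARD('n) + 1}. osc_norm p (D j) f)))"
proof (intro conjI allI impI)
  fix \<mu> :: "(real ^ 'n) measure"
  assume "radon_measure \<mu> \<and> doubling_measure \<mu>"
  then interpret doubling_space \<mu> by (simp add: doubling_space_radon)
  show "\<exists>c>0. \<forall>f :: real ^ 'n \<Rightarrow> real. locally_integrable \<mu> f \<and> (AE x in \<mu>. 0 \<le> f x) \<longrightarrow>
      approx c (seq_weak_norm p \<gamma> \<mu> std_dyadic (a_seq p \<gamma> \<mu> f)) (fun_weak_norm p \<gamma> \<mu> (a_fun p \<gamma> \<mu> f)) \<and>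
      approx c (seq_weak_lim p \<gamma> \<mu> std_dyadic (a_seq p \<gamma> \<mu> f)) (fun_weak_lim p \<gamma> \<mu> (a_fun p \<gamma> \<mu> f))"
    by (rule a_weak_approx[OF assms(1), of \<gamma>]) blast
next
  fix D :: "nat \<Rightarrow> (real ^ 'n) set set" assume D: "ball_covering_family D"
  show "\<exists>c>0. \<forall>f :: real ^ 'n \<Rightarrow> complex. locally_integrable lborel f \<longrightarrow>
      lesssim c (seq_weak_norm p \<gamma> lborel std_dyadic (b_seq p \<gamma> f)) (fun_weak_norm p \<gamma> lborel (b_fun p \<gamma> f)) \<and>
      lesssim c (fun_weak_norm p \<gamma> lborel (b_fun p \<gamma> f))
        (MAX j\<in>{1..CARD('n) + 1}. seq_weak_norm p \<gamma> lborel (D j) (b_seq p \<gamma> f))"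
    unfolding b_seq_def[abs_def] b_fun_def
    by (rule osc_weak_bounds[OF assms(1) D, of \<gamma> "\<gamma> / p"]) blast
next
  fix D :: "nat \<Rightarrow> (real ^ 'n) set set" assume D: "ball_covering_family D"
  have std: "osc_norm p std_dyadic f = seq_weak_norm p p lborel std_dyadic (\<lambda>Q. sidelength Q powr 0 * osc f Q)"
    for f :: "real ^ 'n \<Rightarrow> complex"
    by (intro osc_norm_eq_seq_weak_norm std_dyadic_is_cube)
  have "osc_norm p (D j) f = seq_weak_norm p p lborel (D j) (\<lambda>Q. sidelength Q powr 0 * osc f Q)"
    if "j \<in> {1..CARD('n) + 1}" for j and f :: "real ^ 'n \<Rightarrow> complex"
    using D that unfolding ball_covering_family_def dyadic_system_def
    by (intro osc_norm_eq_seq_weak_norm) blast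
  \<comment> \<open>The systems are known to consist of cubes only for indices in the given range,
    so the identity is stated for the image over which the maximum is taken.\<close>
  then have fam: "(\<lambda>j. osc_norm p (D j) f) ` {1..CARD('n) + 1} =
      (\<lambda>j. seq_weak_norm p p lborel (D j) (\<lambda>Q. sidelength Q powr 0 * osc f Q)) ` {1..CARD('n) + 1}"
    for f :: "real ^ 'n \<Rightarrow> complex"
    by (intro image_cong refl)
  have m: "fun_weak_norm p p lborel (m_fun f) =
      fun_weak_norm p p lborel (\<lambda>(x, t). t powr 0 * osc f (ball x t))"
    for f :: "real ^ 'n \<Rightarrow> complex"
    by (rule fun_weak_norm_cong) (simp add: m_fun_def)
  show "\<exists>c>0. \<forall>f :: real ^ 'n \<Rightarrow> complex. locally_integrable lborel f \<longrightarrow>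
      lesssim c (osc_norm p std_dyadic f) (fun_weak_norm p p lborel (m_fun f)) \<and>
      lesssim c (fun_weak_norm p p lborel (m_fun f)) (MAX j\<in>{1..CARD('n) + 1}. osc_norm p (D j) f)"
    unfolding std fam m
    by (rule osc_weak_bounds[OF assms(1) D, of p 0]) blast
qed

end
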